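(* Every slice Fueter-regular function $f:\Omega_D\to\mathbb{O}$ is real analytic. Equivalently, the stem function inducing any slice Fueter-regular function is real analytic.
   Context: Octonions: $\mathbb{O}=\mathbb{H}+\ell\mathbb{H}$ with product $(a+\ell b)(c+\ell d)=(ac-d\bar b)+\ell(\bar a d+cb)$ and conjugation $\overline{a+\ell b}=\bar a-\ell b$; $\mathbb{O}$ is identified with $\mathbb{R}^8$ via the basis $(1,i,j,k,\ell,\ell i,\ell j,\ell k)$. $\mathbb{S}=\{I\in\mathbb{O}:I^2=-1\}$. Let $D\subset\mathbb{R}^2$ be a non-empty open set invariant under $(\alpha,\beta)\mapsto(\alpha,-\beta)$, $\Omega_D=\{\alpha+\beta I:(\alpha,\beta)\in D,I\in\mathbb{S}\}$, assumed connected. A stem function is $F=(F_1,F_2):D\to\mathbb{O}^2$ with $F_1$ even and $F_2$ odd in the second variable; $f:\Omega_D\to\mathbb{O}$ is a slice function induced by $F$ if $f(\alpha+\beta I)=F_1(\alpha,\beta)+IF_2(\alpha,\beta)$ for all $(\alpha,\beta)\in D,I\in\mathbb{S}$. Let $E=\{(x_0,x_1,x_2,x_3)\in\mathbb{R}^4:(x_0,(x_1^2+x_2^2+x_3^2)^{1/2})\in D\}$; $O(3)$ denotes the real orthogonal $4\times4$ matrices fixing the first canonical basis vector, acting on $\mathbb{R}^4$ and $\mathbb{O}^4$ by matrix–column multiplication. $\mathcal N=\{(I,J)\in\mathbb{S}^2:I\perp J\}$. An $O(3)$-stem function is $\mathcal F=(\mathcal F_0,\dots,\mathcal F_3):E\to\mathbb{O}^4$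 with $\mathcal F(Av)=A\mathcal F(v)$ for $A\in O(3)$; it induces the well-defined function $f:\Omega_D\to\mathbb{O}$, $f(x_0+x_1I+x_2J+x_3(IJ))=\mathcal F_0(v)+I\mathcal F_1(v)+J\mathcal F_2(v)+(IJ)\mathcal F_3(v)$ for $v=(x_0,\dots,x_3)\in E$, $(I,J)\in\mathcal N$ (every point of $\Omega_D$ is of this form). Such $f$ is always a slice function. $f$ is slice Fueter-regular if it is induced by an $O(3)$-stem function $\mathcal F$ of class $C^1$ satisfying on $E$ (with $\partial_h=\partial/\partial x_h$): $\partial_0\mathcal F_0-\partial_1\mathcal F_1-\partial_2\mathcal F_2-\partial_3\mathcal F_3=0$, $\partial_1\mathcal F_0+\partial_0\mathcal F_1-\partial_3\mathcal F_2+\partial_2\mathcal F_3=0$, $\partial_2\mathcal F_0+\partial_3\mathcal F_1+\partial_0\mathcal F_2-\partial_1\mathcal F_3=0$, $\partial_3\mathcal F_0-\partial_2\mathcal F_1+\partial_1\mathcal F_2+\partial_0\mathcal F_3=0$. *)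

theory Defs
  imports "HOL-Analysis.Analysis"
begin

text \<open>Quaternions are real^4 with coordinates 0,1,2,3 w.r.t. the basis (1,i,j,k).
  Octonions are real^8 with coordinates 0..7 w.r.t. the basis (1,i,j,k,l,li,lj,lk),
  i.e. the octonion a + l b (a,b quaternions) has coordinates (a0,a1,a2,a3,b0,b1,b2,b3).\<close>

definition qmk :: "real \<Rightarrow> real \<Rightarrow> real \<Rightarrow> real \<Rightarrow> real^4" where
  "qmk a b c d = (\<chi> i. if i = 0 then a else if i = 1 then b else if i = 2 then c else d)"

definition qmul :: "real^4 \<Rightarrow> real^4 \<Rightarrow> real^4" where
  "qmul a b = qmk
     (a$0*b$0 - a$1*b$1 - a$2*b$2 - a$3*b$3)
     (a$0*b$1 + a$1*b$0 + a$2*b$3 - a$3*b$2)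
     (a$0*b$2 - a$1*b$3 + a$2*b$0 + a$3*b$1)
     (a$0*b$3 + a$1*b$2 - a$2*b$1 + a$3*b$0)"

definition qconj :: "real^4 \<Rightarrow> real^4" where
  "qconj a = qmk (a$0) (- a$1) (- a$2) (- a$3)"

definition omk :: "real^4 \<Rightarrow> real^4 \<Rightarrow> real^8" where
  "omk a b = (\<chi> i. if i = 0 then a$0 else if i = 1 then a$1 else if i = 2 then a$2
      else if i = 3 then a$3 else if i = 4 then b$0 else if i = 5 then b$1
      else if i = 6 then b$2 else b$3)"

definition oq1 :: "real^8 \<Rightarrow> real^4" where
  "oq1 x = qmk (x$0) (x$1) (x$2) (x$3)"

definition oq2 :: "real^8 \<Rightarrow> real^4" where
  "oq2 x = qmk (x$4) (x$5) (x$6) (x$7)"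

definition omul :: "real^8 \<Rightarrow> real^8 \<Rightarrow> real^8" where
  "omul x y = omk (qmul (oq1 x) (oq1 y) - qmul (oq2 y) (qconj (oq2 x)))
                  (qmul (qconj (oq1 x)) (oq2 y) + qmul (oq1 y) (oq2 x))"

definition oconj :: "real^8 \<Rightarrow> real^8" where
  "oconj x = omk (qconj (oq1 x)) (- oq2 x)"

text \<open>The octonion unit 1 (real numbers r are embedded as r *R oone).\<close>
definition oone :: "real^8" where
  "oone = axis 0 1"

definition imag_units :: "(real^8) set" where
  "imag_units = {I. omul I I = - oone}"

definition orth_pairs :: "((real^8) \<times> (real^8)) set" where
  "orth_pairs = {(I, J). I \<in> imag_units \<and> J \<in> imag_units \<and> I \<bullet> J = 0}"

definition OmegaD :: "(real \<times> real) set \<Rightarrow> (real^8) set" where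
  "OmegaD D = {\<alpha> *\<^sub>R oone + \<beta> *\<^sub>R I | \<alpha> \<beta> I. (\<alpha>, \<beta>) \<in> D \<and> I \<in> imag_units}"

definition EsetD :: "(real \<times> real) set \<Rightarrow> (real^4) set" where
  "EsetD D = {v. (v$0, sqrt ((v$1)\<^sup>2 + (v$2)\<^sup>2 + (v$3)\<^sup>2)) \<in> D}"

definition O3 :: "(real^4^4) set" where
  "O3 = {A. orthogonal_matrix A \<and> A *v axis 0 1 = axis 0 1}"

definition oact :: "real^4^4 \<Rightarrow> (real^8)^4 \<Rightarrow> (real^8)^4" where
  "oact A F = (\<chi> h. \<Sum>k\<in>UNIV. (A$h$k) *\<^sub>R (F$k))"

definition is_O3_stem :: "(real \<times> real) set \<Rightarrow> (real^4 \<Rightarrow> (real^8)^4) \<Rightarrow> bool" where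
  "is_O3_stem D F \<longleftrightarrow> (\<forall>v\<in>EsetD D. \<forall>A\<in>O3. F (A *v v) = oact A (F v))"

definition O3_induces :: "(real \<times> real) set \<Rightarrow> (real^4 \<Rightarrow> (real^8)^4) \<Rightarrow> (real^8 \<Rightarrow> real^8) \<Rightarrow> bool" where
  "O3_induces D F f \<longleftrightarrow>
     (\<forall>v\<in>EsetD D. \<forall>I J. (I, J) \<in> orth_pairs \<longrightarrow>
        f (v$0 *\<^sub>R oone + v$1 *\<^sub>R I + v$2 *\<^sub>R J + v$3 *\<^sub>R omul I J)
          = F v $ 0 + omul I (F v $ 1) + omul J (F v $ 2) + omul (omul I J) (F v $ 3))"

definition pd :: "(real^4 \<Rightarrow> (real^8)^4) \<Rightarrow> 4 \<Rightarrow> real^4 \<Rightarrow> (real^8)^4" where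
  "pd F h v = frechet_derivative F (at v) (axis h 1)"

definition C1_on :: "(real^4 \<Rightarrow> (real^8)^4) \<Rightarrow> (real^4) set \<Rightarrow> bool" where
  "C1_on F E \<longleftrightarrow> F differentiable_on E \<and> (\<forall>h. continuous_on E (pd F h))"

definition slice_fueter_regular :: "(real \<times> real) set \<Rightarrow> (real^8 \<Rightarrow> real^8) \<Rightarrow> bool" where
  "slice_fueter_regular D f \<longleftrightarrow>
    (\<exists>F. is_O3_stem D F \<and> O3_induces D F f \<and> C1_on F (EsetD D) \<and>
      (\<forall>v\<in>EsetD D.
         pd F 0 v $ 0 - pd F 1 v $ 1 - pd F 2 v $ 2 - pd F 3 v $ 3 = 0 \<and>
         pd F 1 v $ 0 + pd F 0 v $ 1 - pd F 3 v $ 2 + pd F 2 v $ 3 = 0 \<and>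
         pd F 2 v $ 0 + pd F 3 v $ 1 + pd F 0 v $ 2 - pd F 1 v $ 3 = 0 \<and>
         pd F 3 v $ 0 - pd F 2 v $ 1 + pd F 1 v $ 2 + pd F 0 v $ 3 = 0))"

definition real_analytic_on :: "(real^'n \<Rightarrow> 'b::real_normed_vector) \<Rightarrow> (real^'n) set \<Rightarrow> bool" where
  "real_analytic_on f S \<longleftrightarrow>
    (\<forall>a\<in>S. \<exists>r>0. \<exists>c :: ('n \<Rightarrow> nat) \<Rightarrow> 'b. \<forall>x\<in>ball a r. x \<in> S \<and>
       ((\<lambda>\<alpha>. (\<Prod>i\<in>UNIV. (x$i - a$i) ^ (\<alpha> i)) *\<^sub>R c \<alpha>) has_sum f x) UNIV)"

end

(*
  On the plane v = (t, r, 0, 0), equivariance under O(3) kills F_2 and F_3 and turns the Fueter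
  system for u = F_0 and w = F_1 into r u_t = r w_r + 2 w and w_t = - u_r.  The second equation gives
  a potential s with s_t = - u and s_r = w, and then the first one says that r u + i (r w + s) is
  holomorphic in z = t + i r.  With a suitable primitive K of - i times that function,
  r s = Im K, r u = - Im K' and r^2 w = r Re K' - Im K.
  At x = t + y with y purely imaginary, f(x) = u(t, |y|) + y (w(t, |y|) / |y|), so it remains to see
  that u and w / r are analytic in (t, y).  Off the real axis |y| = sqrt(y . y) is analytic and the
  formulas for u and w suffice.  At a real point K has real Taylor coefficients, and
  u and w / r are series of polynomials in t and r^2 which converge absolutely coefficientwise.
*)

theory Submission
  imports Defs "HOL-Complex_Analysis.Cauchy_Integral_Formula"
begin

section \<open>Majorized power series\<close>

text \<open>\<open>real_analytic_on\<close> demands an unordered sum over multi-indices in eight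
  variables. A convergent series of polynomials in t and r^2 is not yet of that form: its expansion
  into monomials has to converge with all signs ignored. Hence the bookkeeping by a weighted l^1
  norm of coefficients, which is submultiplicative and so follows recursions. Its price is a smaller
  radius, since ignoring signs replaces |t + i r| by |t| + |r|. The unit y / |y| has no limit at a
  real point, so w must be divided by r, and through the formula for r^2 w this means dividing by
  r^3 inside a power series. The term 2 w stems from d_2 F_2 and d_3 F_3: on the plane, rotating
  coordinate 1 into coordinate k gives r d_k F_k = F_1. Passing to the primitive K removes the
  potential s: as r s = Im K, both u and w are expressed by K and K' alone. The same identity makes
  Im K vanish for r = 0, whence the real Taylor coefficients.\<close>

definition tdeg :: "('n::finite \<Rightarrow> nat) \<Rightarrow> nat" where
  "tdeg \<alpha> = (\<Sum>i\<in>UNIV. \<alpha> i)"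

definition mpow :: "('n::finite \<Rightarrow> nat) \<Rightarrow> real^'n \<Rightarrow> real" where
  "mpow \<alpha> x = (\<Prod>i\<in>UNIV. (x$i) ^ \<alpha> i)"

definition cube :: "real \<Rightarrow> (real^'n) set" where
  "cube \<rho> = {x. \<forall>i. \<bar>x$i\<bar> \<le> \<rho>}"

text \<open>\<open>M\<close> bounds a weighted l^1 norm of the coefficients. Unlike a supremum over
  the real cube, such a bound controls regroupings into monomials.\<close>

definition majorized :: "real \<Rightarrow> real \<Rightarrow> (real^'n \<Rightarrow> 'b::banach) \<Rightarrow> bool" where
  "majorized \<rho> M g \<longleftrightarrow> (\<exists>c. (\<lambda>\<alpha>. norm (c \<alpha>) * \<rho> ^ tdeg \<alpha>) summable_on UNIV \<and>
     (\<Sum>\<^sub>\<infinity>\<alpha>. norm (c \<alpha>) * \<rho> ^ tdeg \<alpha>) \<le> M \<and>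
     (\<forall>x\<in>cube \<rho>. ((\<lambda>\<alpha>. mpow \<alpha> x *\<^sub>R c \<alpha>) has_sum g x) UNIV))"

lemma mpow_add: "mpow (\<lambda>i. \<alpha> i + \<beta> i) x = mpow \<alpha> x * mpow \<beta> x"
  by (simp add: mpow_def power_add prod.distrib)

lemma tdeg_add: "tdeg (\<lambda>i. \<alpha> i + \<beta> i) = tdeg \<alpha> + tdeg \<beta>"
  by (simp add: tdeg_def sum.distrib)

lemma abs_mpow_le: "x \<in> cube \<rho> \<Longrightarrow> \<bar>mpow \<alpha> x\<bar> \<le> \<rho> ^ tdeg \<alpha>"
  unfolding mpow_def tdeg_def power_sum abs_prod cube_def
  by (intro prod_mono) (auto simp: power_abs intro: power_mono)

lemma cube_mono: "\<rho> \<le> \<rho>' \<Longrightarrow> cube \<rho> \<subseteq> cube \<rho>'"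
  unfolding cube_def by (blast intro: order_trans)

lemma majorizedI_coeffs:
  assumes "\<rho> > 0" "\<And>\<alpha>. norm (c \<alpha>) * \<rho> ^ tdeg \<alpha> \<le> n \<alpha>" "(n has_sum N) UNIV" "N \<le> M"
    and "\<And>x. x \<in> cube \<rho> \<Longrightarrow> ((\<lambda>\<alpha>. mpow \<alpha> x *\<^sub>R c \<alpha>) has_sum g x) UNIV"
  shows "majorized \<rho> M g"
proof -
  have s: "(\<lambda>\<alpha>. norm (c \<alpha>) * \<rho> ^ tdeg \<alpha>) summable_on UNIV"
    by (rule summable_on_comparison_test[OF has_sum_imp_summable[OF assms(3)]]) (use assms(1,2) in auto)
  have "(\<Sum>\<^sub>\<infinity>\<alpha>. norm (c \<alpha>) * \<rho> ^ tdeg \<alpha>) \<le> N"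
    by (rule has_sum_mono[OF has_sum_infsum[OF s] assms(3)]) (use assms(2) in auto)
  with s assms(4,5) show ?thesis
    unfolding majorized_def by (intro exI[of _ c]) auto
qed

text \<open>The exponents \<open>m j\<close> may repeat; the coefficient of a monomial collects the \<open>b j\<close> belonging to it.\<close>

lemma majorizedI:
  fixes b :: "'j \<Rightarrow> 'b::banach" and m :: "'j \<Rightarrow> 'n::finite \<Rightarrow> nat"
  assumes \<rho>: "\<rho> > 0"
    and N: "((\<lambda>j. norm (b j) * \<rho> ^ tdeg (m j)) has_sum N) UNIV" "N \<le> M"
    and g: "\<And>x. x \<in> cube \<rho> \<Longrightarrow> ((\<lambda>j. mpow (m j) x *\<^sub>R b j) has_sum g x) UNIV"
  shows "majorized \<rho> M g"
proof -
  \<comment> \<open>The fibres of \<open>m\<close> partition the index type. Via \<open>bij\<close>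
    a sum over indices becomes a double sum over multi-indices and fibres, whose inner sums are then
    collected by \<open>has_sum_SigmaD\<close>.\<close>
  define B where "B \<alpha> = {j. m j = \<alpha>}" for \<alpha>
  have bij: "bij_betw snd (Sigma UNIV B) UNIV"
    by (rule bij_betw_byWitness[where f' = "\<lambda>j. (m j, j)"]) (auto simp: B_def)
  have sig: "(h has_sum S) UNIV \<Longrightarrow> ((\<lambda>p. h (snd p)) has_sum S) (Sigma UNIV B)"
    for h :: "'j \<Rightarrow> 'c::{comm_monoid_add,topological_space}" and S
    using has_sum_reindex_bij_betw[OF bij] by blast
  have fib: "(\<lambda>j. norm (b j)) summable_on B \<alpha>" for \<alpha>
  proof -
    have "(\<lambda>j. norm (b j) * \<rho> ^ tdeg (m j)) summable_on B \<alpha>"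
      using N(1) summable_on_subset_banach has_sum_imp_summable subset_UNIV by blast
    then have "(\<lambda>j. (norm (b j) * \<rho> ^ tdeg (m j)) * inverse (\<rho> ^ tdeg \<alpha>)) summable_on B \<alpha>"
      by (rule summable_on_cmult_left)
    then show ?thesis
      by (rule summable_on_cong[THEN iffD1, rotated]) (use \<rho> in \<open>auto simp: B_def\<close>)
  qed
  define c where "c \<alpha> = infsum b (B \<alpha>)" for \<alpha>
  define n where "n \<alpha> = (\<Sum>\<^sub>\<infinity>j\<in>B \<alpha>. norm (b j))" for \<alpha>
  have c: "(b has_sum c \<alpha>) (B \<alpha>)" for \<alpha>
    unfolding c_def using fib abs_summable_summable by (intro has_sum_infsum) blast
  have n: "((\<lambda>j. norm (b j)) has_sum n \<alpha>) (B \<alpha>)" for \<alpha>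
    unfolding n_def by (intro has_sum_infsum fib)
  have nc: "norm (c \<alpha>) \<le> n \<alpha>" for \<alpha>
    by (rule norm_has_sum_bound[OF n c])
  have nsum: "((\<lambda>\<alpha>. n \<alpha> * \<rho> ^ tdeg \<alpha>) has_sum N) UNIV"
  proof (rule has_sum_SigmaD[OF sig[OF N(1)]])
    fix \<alpha> :: "'n \<Rightarrow> nat"
    have "((\<lambda>j. norm (b j) * \<rho> ^ tdeg \<alpha>) has_sum n \<alpha> * \<rho> ^ tdeg \<alpha>) (B \<alpha>)"
      by (rule has_sum_cmult_left[OF n])
    then show "((\<lambda>j. norm (b (snd (\<alpha>, j))) * \<rho> ^ tdeg (m (snd (\<alpha>, j)))) has_sum n \<alpha> * \<rho> ^ tdeg \<alpha>) (B \<alpha>)"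
      by (rule has_sum_cong[THEN iffD1, rotated]) (auto simp: B_def)
  qed
  have "((\<lambda>\<alpha>. mpow \<alpha> x *\<^sub>R c \<alpha>) has_sum g x) UNIV" if "x \<in> cube \<rho>" for x
  proof (rule has_sum_SigmaD[OF sig[OF g[OF that]]])
    fix \<alpha> :: "'n \<Rightarrow> nat"
    have "((\<lambda>j. mpow \<alpha> x *\<^sub>R b j) has_sum mpow \<alpha> x *\<^sub>R c \<alpha>) (B \<alpha>)"
      by (rule has_sum_scaleR[OF c])
    then show "((\<lambda>j. mpow (m (snd (\<alpha>, j))) x *\<^sub>R b (snd (\<alpha>, j))) has_sum mpow \<alpha> x *\<^sub>R c \<alpha>) (B \<alpha>)"
      by (rule has_sum_cong[THEN iffD1, rotated]) (auto simp: B_def)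
  qed
  then show ?thesis
    by (intro majorizedI_coeffs[OF \<rho> _ nsum N(2)]) (use \<rho> nc in \<open>auto intro: mult_right_mono\<close>)
qed

lemma majorizedE:
  assumes "majorized \<rho> M g"
  obtains c N where "((\<lambda>\<alpha>. norm (c \<alpha>) * \<rho> ^ tdeg \<alpha>) has_sum N) UNIV" "N \<le> M"
    "\<And>x. x \<in> cube \<rho> \<Longrightarrow> ((\<lambda>\<alpha>. mpow \<alpha> x *\<^sub>R c \<alpha>) has_sum g x) UNIV"
  using assms unfolding majorized_def by (meson has_sum_infsum)

text \<open>On the cube each monomial is at most its weight. This supplies pointwise convergence of
  series of functions and keeps values inside discs of convergence.\<close>

lemma majorized_norm_le:
  assumes "majorized \<rho> M g" "x \<in> cube \<rho>"
  shows "norm (g x) \<le> M"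
proof -
  obtain c N where c: "((\<lambda>\<alpha>. norm (c \<alpha>) * \<rho> ^ tdeg \<alpha>) has_sum N) UNIV" "N \<le> M"
    "\<And>x. x \<in> cube \<rho> \<Longrightarrow> ((\<lambda>\<alpha>. mpow \<alpha> x *\<^sub>R c \<alpha>) has_sum g x) UNIV"
    by (rule majorizedE[OF assms(1)]) blast
  have le: "norm (mpow \<alpha> x *\<^sub>R c \<alpha>) \<le> norm (c \<alpha>) * \<rho> ^ tdeg \<alpha>" for \<alpha>
    using mult_left_mono[OF abs_mpow_le[OF assms(2)], of "norm (c \<alpha>)" \<alpha>] by (simp add: mult.commute)
  have s: "(\<lambda>\<alpha>. norm (mpow \<alpha> x *\<^sub>R c \<alpha>)) summable_on UNIV"
    by (rule summable_on_comparison_test[OF has_sum_imp_summable[OF c(1)]]) (use le in auto)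
  have "norm (g x) \<le> (\<Sum>\<^sub>\<infinity>\<alpha>. norm (mpow \<alpha> x *\<^sub>R c \<alpha>))"
    by (rule norm_has_sum_bound[OF has_sum_infsum[OF s] c(3)[OF assms(2)]])
  also have "\<dots> \<le> N"
    by (rule has_sum_mono[OF has_sum_infsum[OF s] c(1)]) (use le in auto)
  finally show ?thesis using c(2) by simp
qed

lemma majorized_mono:
  assumes "majorized \<rho> M g" "0 < \<rho>'" "\<rho>' \<le> \<rho>" "M \<le> M'"
  shows "majorized \<rho>' M' g"
proof -
  obtain c N where c: "((\<lambda>\<alpha>. norm (c \<alpha>) * \<rho> ^ tdeg \<alpha>) has_sum N) UNIV" "N \<le> M"
    "\<And>x. x \<in> cube \<rho> \<Longrightarrow> ((\<lambda>\<alpha>. mpow \<alpha> x *\<^sub>R c \<alpha>) has_sum g x) UNIV"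
    by (rule majorizedE[OF assms(1)]) blast
  have le: "norm (c \<alpha>) * \<rho>' ^ tdeg \<alpha> \<le> norm (c \<alpha>) * \<rho> ^ tdeg \<alpha>" for \<alpha>
    using assms by (intro mult_left_mono power_mono) auto
  show ?thesis
    by (rule majorizedI_coeffs[OF assms(2) le c(1)]) (use c cube_mono[OF assms(3)] assms(4) in auto)
qed

lemma majorized_cong:
  assumes "majorized \<rho> M g" "\<And>x. x \<in> cube \<rho> \<Longrightarrow> g x = h x"
  shows "majorized \<rho> M h"
  using assms unfolding majorized_def by simp

lemma majorized_const: "\<rho> > 0 \<Longrightarrow> majorized \<rho> (norm k) (\<lambda>_::real^'n. k)"
  by (rule majorizedI[where b = "\<lambda>_::unit. k" and m = "\<lambda>_ _. 0" and N = "norm k"])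
    (auto simp: mpow_def tdeg_def UNIV_unit intro!: has_sum_finiteI)

lemma majorized_zero: "\<rho> > 0 \<Longrightarrow> M \<ge> 0 \<Longrightarrow> majorized \<rho> M (\<lambda>_::real^'n. 0 :: 'b::banach)"
  using majorized_mono[OF majorized_const[of \<rho> "0::'b"] _ order_refl] by simp

lemma majorized_coord: "\<rho> > 0 \<Longrightarrow> majorized \<rho> \<rho> (\<lambda>x::real^'n. x$i)"
  by (rule majorizedI[where b = "\<lambda>_::unit. 1" and m = "\<lambda>_ k. if k = i then 1 else 0" and N = \<rho>])
    (auto simp: mpow_def tdeg_def UNIV_unit if_distrib[of "\<lambda>k. _ ^ k"] cong: if_cong intro!: has_sum_finiteI)

lemma majorized_linear:
  assumes "bounded_linear T" "\<And>a. norm (T a) \<le> norm a * K" "majorized \<rho> M g" "\<rho> > 0" "K \<ge> 0"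
  shows "majorized \<rho> (M * K) (\<lambda>x. T (g x))"
proof -
  obtain c N where c: "((\<lambda>\<alpha>. norm (c \<alpha>) * \<rho> ^ tdeg \<alpha>) has_sum N) UNIV" "N \<le> M"
    "\<And>x. x \<in> cube \<rho> \<Longrightarrow> ((\<lambda>\<alpha>. mpow \<alpha> x *\<^sub>R c \<alpha>) has_sum g x) UNIV"
    by (rule majorizedE[OF assms(3)]) blast
  have le: "norm (T (c \<alpha>)) * \<rho> ^ tdeg \<alpha> \<le> (norm (c \<alpha>) * \<rho> ^ tdeg \<alpha>) * K" for \<alpha>
    using mult_right_mono[OF assms(2)[of "c \<alpha>"], of "\<rho> ^ tdeg \<alpha>"] assms(4) by (simp add: mult_ac)
  have c': "((\<lambda>\<alpha>. (norm (c \<alpha>) * \<rho> ^ tdeg \<alpha>) * K) has_sum N * K) UNIV"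
    by (rule has_sum_cmult_left[OF c(1)])
  have "N * K \<le> M * K" using c(2) assms(5) by (rule mult_right_mono)
  moreover have "((\<lambda>\<alpha>. mpow \<alpha> x *\<^sub>R T (c \<alpha>)) has_sum T (g x)) UNIV" if "x \<in> cube \<rho>" for x
    using has_sum_bounded_linear[OF assms(1) c(3)[OF that]]
    by (simp add: linear_simps(5)[OF assms(1)])
  ultimately show ?thesis by (intro majorizedI_coeffs[OF assms(4) le c'])
qed

text \<open>A monomial factor shifts all exponents and scales the weighted norm by its own weight.
  Products are built from this case.\<close>

lemma majorized_mpow_scaleR:
  assumes "majorized \<rho> M g" "\<rho> > 0"
  shows "majorized \<rho> (\<rho> ^ tdeg \<alpha> * M) (\<lambda>x. mpow \<alpha> x *\<^sub>R g x)"
proof -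
  obtain c N where c: "((\<lambda>\<alpha>. norm (c \<alpha>) * \<rho> ^ tdeg \<alpha>) has_sum N) UNIV" "N \<le> M"
    "\<And>x. x \<in> cube \<rho> \<Longrightarrow> ((\<lambda>\<alpha>. mpow \<alpha> x *\<^sub>R c \<alpha>) has_sum g x) UNIV"
    by (rule majorizedE[OF assms(1)]) blast
  show ?thesis
  proof (rule majorizedI[where b = c and m = "\<lambda>\<beta> i. \<alpha> i + \<beta> i" and N = "\<rho> ^ tdeg \<alpha> * N"])
    show "((\<lambda>\<beta>. norm (c \<beta>) * \<rho> ^ tdeg (\<lambda>i. \<alpha> i + \<beta> i)) has_sum \<rho> ^ tdeg \<alpha> * N) UNIV"
      using has_sum_cmult_right[OF c(1), of "\<rho> ^ tdeg \<alpha>"] by (simp add: tdeg_add power_add mult_ac)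
    show "((\<lambda>\<beta>. mpow (\<lambda>i. \<alpha> i + \<beta> i) x *\<^sub>R c \<beta>) has_sum mpow \<alpha> x *\<^sub>R g x) UNIV" if "x \<in> cube \<rho>" for x
      using has_sum_scaleR[OF c(3)[OF that], of "mpow \<alpha> x"] by (simp add: mpow_add)
  qed (use assms c in auto)
qed

text \<open>Completeness of the weighted l^1 norm: the coefficients over pairs of a series index and
  a multi-index form an absolutely summable family, which \<open>majorizedI\<close> regroups by
  monomial.\<close>

lemma majorized_has_sum:
  fixes g :: "'k \<Rightarrow> real^'n \<Rightarrow> 'b::banach"
  assumes \<rho>: "\<rho> > 0" and g: "\<And>k. majorized \<rho> (M k) (g k)" and M: "(M has_sum N) UNIV"
    and G: "\<And>x. x \<in> cube \<rho> \<Longrightarrow> ((\<lambda>k. g k x) has_sum G x) UNIV"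
  shows "majorized \<rho> N G"
proof -
  define P where "P k c s \<longleftrightarrow> ((\<lambda>\<alpha>. norm (c \<alpha>) * \<rho> ^ tdeg \<alpha>) has_sum s) UNIV \<and> s \<le> M k \<and>
    (\<forall>x \<in> cube \<rho>. ((\<lambda>\<alpha>. mpow \<alpha> x *\<^sub>R c \<alpha>) has_sum g k x) UNIV)" for k c s
  have "\<exists>c s. P k c s" for k
    unfolding P_def by (rule majorizedE[OF g[of k]]) blast
  then obtain c s where "\<And>k. P k (c k) (s k)" by metis
  then have c: "\<And>k. ((\<lambda>\<alpha>. norm (c k \<alpha>) * \<rho> ^ tdeg \<alpha>) has_sum s k) UNIV" "\<And>k. s k \<le> M k"
    "\<And>k x. x \<in> cube \<rho> \<Longrightarrow> ((\<lambda>\<alpha>. mpow \<alpha> x *\<^sub>R c k \<alpha>) has_sum g k x) UNIV"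
    unfolding P_def by blast+
  have s0: "0 \<le> s k" for k
    by (rule has_sum_nonneg[OF c(1)]) (use \<rho> in auto)
  have s: "s summable_on UNIV"
    by (rule summable_on_comparison_test[OF has_sum_imp_summable[OF M]]) (use c s0 in auto)
  let ?h = "\<lambda>p. norm (c (fst p) (snd p)) * \<rho> ^ tdeg (snd p)"
  have h: "?h summable_on (Sigma UNIV (\<lambda>_. UNIV))"
    by (rule summable_on_SigmaI[where g = s]) (use c s \<rho> in auto)
  then obtain N' where N': "(?h has_sum N') (Sigma UNIV (\<lambda>_. UNIV))"
    by (auto simp: summable_on_def)
  have "(s has_sum N') UNIV"
    by (rule has_sum_SigmaD[OF N']) (use c in auto)
  then have "N' \<le> N"
    by (rule has_sum_mono[OF _ M]) (use c in auto)
  show ?thesis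
  proof (rule majorizedI[where b = "\<lambda>p. c (fst p) (snd p)" and m = snd and N = N'])
    fix x :: "real^'n" assume x: "x \<in> cube \<rho>"
    let ?f = "\<lambda>p. mpow (snd p) x *\<^sub>R c (fst p) (snd p)"
    have "norm (?f p) \<le> ?h p" for p
      using mult_left_mono[OF abs_mpow_le[OF x], of "norm (c (fst p) (snd p))" "snd p"]
      by (simp add: mult.commute)
    then have "?f abs_summable_on Sigma UNIV (\<lambda>_. UNIV)"
      by (intro summable_on_comparison_test[OF h]) auto
    then have "?f summable_on Sigma UNIV (\<lambda>_. UNIV)"
      by (rule abs_summable_summable)
    then obtain X where X: "(?f has_sum X) (Sigma UNIV (\<lambda>_. UNIV))"
      by (auto simp: summable_on_def)
    \<comment> \<open>Summing the pairs by their first component identifies the total with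
      \<open>G x\<close>.\<close>
    have "((\<lambda>k. g k x) has_sum X) UNIV"
      by (rule has_sum_SigmaD[OF X]) (use c x in auto)
    then have "X = G x" using G[OF x] has_sum_unique by blast
    then show "(?f has_sum G x) UNIV" using X by simp
  qed (use N' \<open>N' \<le> N\<close> \<rho> in auto)
qed

lemma majorized_infsum:
  fixes g :: "'k \<Rightarrow> real^'n \<Rightarrow> 'b::banach"
  assumes "\<rho> > 0" "\<And>k. majorized \<rho> (M k) (g k)" "M summable_on UNIV"
  shows "majorized \<rho> (\<Sum>\<^sub>\<infinity>k. M k) (\<lambda>x. \<Sum>\<^sub>\<infinity>k. g k x)"
    and "x \<in> cube \<rho> \<Longrightarrow> ((\<lambda>k. g k x) has_sum (\<Sum>\<^sub>\<infinity>k. g k x)) UNIV"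
proof -
  show *: "((\<lambda>k. g k x) has_sum (\<Sum>\<^sub>\<infinity>k. g k x)) UNIV" if "x \<in> cube \<rho>" for x
  proof (intro has_sum_infsum)
    have "(\<lambda>k. g k x) abs_summable_on UNIV"
      by (rule summable_on_comparison_test[OF assms(3)]) (use majorized_norm_le[OF assms(2) that] in auto)
    then show "(\<lambda>k. g k x) summable_on UNIV" by (rule abs_summable_summable)
  qed
  show "majorized \<rho> (\<Sum>\<^sub>\<infinity>k. M k) (\<lambda>x. \<Sum>\<^sub>\<infinity>k. g k x)"
    by (rule majorized_has_sum[OF assms(1,2) has_sum_infsum[OF assms(3)] *])
qed

lemma majorized_sum:
  fixes g :: "'k::finite \<Rightarrow> real^'n \<Rightarrow> 'b::banach"
  assumes "\<rho> > 0" "\<And>k. majorized \<rho> (M k) (g k)"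
  shows "majorized \<rho> (\<Sum>k\<in>UNIV. M k) (\<lambda>x. \<Sum>k\<in>UNIV. g k x)"
  by (rule majorized_has_sum[OF assms]) (auto intro!: has_sum_finiteI)

lemma majorized_add:
  assumes "\<rho> > 0" "majorized \<rho> M g" "majorized \<rho> M' h"
  shows "majorized \<rho> (M + M') (\<lambda>x. g x + h x)"
  using majorized_sum[where M = "\<lambda>b. if b then M else M'" and g = "\<lambda>b. if b then g else h" and \<rho> = \<rho>] assms
  by (simp add: UNIV_bool add.commute)

text \<open>Only the first factor is expanded: each monomial of \<open>g\<close> contributes a
  shifted linear image of \<open>h\<close>, and \<open>majorized_has_sum\<close> adds these
  up.\<close>

lemma majorized_bilinear:
  assumes p: "bounded_bilinear p" "\<And>a b. norm (p a b) \<le> norm a * norm b * K" "K \<ge> 0"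
    and \<rho>: "\<rho> > 0" and g: "majorized \<rho> M g" and h: "majorized \<rho> M' h" and "M' \<ge> 0"
  shows "majorized \<rho> (M * M' * K) (\<lambda>x. p (g x) (h x))"
proof -
  interpret bounded_bilinear p by fact
  obtain c N where c: "((\<lambda>\<alpha>. norm (c \<alpha>) * \<rho> ^ tdeg \<alpha>) has_sum N) UNIV" "N \<le> M"
    "\<And>x. x \<in> cube \<rho> \<Longrightarrow> ((\<lambda>\<alpha>. mpow \<alpha> x *\<^sub>R c \<alpha>) has_sum g x) UNIV"
    by (rule majorizedE[OF g]) blast
  have t: "majorized \<rho> (\<rho> ^ tdeg \<alpha> * (M' * (norm (c \<alpha>) * K))) (\<lambda>x. mpow \<alpha> x *\<^sub>R p (c \<alpha>) (h x))" for \<alpha>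
    by (intro majorized_mpow_scaleR majorized_linear[OF bounded_linear_right])
      (use p(3) p(2)[of "c \<alpha>"] \<rho> h in \<open>auto simp: mult_ac\<close>)
  have "majorized \<rho> (N * (M' * K)) (\<lambda>x. p (g x) (h x))"
  proof (rule majorized_has_sum[OF \<rho> t])
    show "((\<lambda>\<alpha>. \<rho> ^ tdeg \<alpha> * (M' * (norm (c \<alpha>) * K))) has_sum N * (M' * K)) UNIV"
      using has_sum_cmult_left[OF c(1), of "M' * K"] by (simp add: mult_ac)
    show "((\<lambda>\<alpha>. mpow \<alpha> x *\<^sub>R p (c \<alpha>) (h x)) has_sum p (g x) (h x)) UNIV" if "x \<in> cube \<rho>" for x
      using has_sum_bounded_linear[OF bounded_linear_left[of "h x"] c(3)[OF that]] by (simp add: scaleR_left)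
  qed
  then show ?thesis
    by (rule majorized_mono) (use assms c(2) in \<open>auto simp: mult.assoc intro!: mult_right_mono\<close>)
qed

lemma majorized_mult:
  fixes g h :: "real^'n \<Rightarrow> 'b::{banach,real_normed_algebra}"
  assumes "\<rho> > 0" "majorized \<rho> M g" "majorized \<rho> M' h" "M' \<ge> 0"
  shows "majorized \<rho> (M * M') (\<lambda>x. g x * h x)"
  using majorized_bilinear[OF bounded_bilinear_mult _ _ assms, of 1] by (simp add: norm_mult_ineq)

lemma majorized_cmult:
  fixes k :: real
  assumes "\<rho> > 0" "majorized \<rho> M g"
  shows "majorized \<rho> (\<bar>k\<bar> * M) (\<lambda>x. k * g x)"
  using majorized_linear[OF bounded_linear_mult_right _ assms(2) assms(1), of k "\<bar>k\<bar>"]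
  by (simp add: abs_mult mult_ac)

lemma majorized_power:
  fixes g :: "real^'n \<Rightarrow> 'b::{banach,real_normed_algebra_1}"
  assumes "\<rho> > 0" "majorized \<rho> M g" "M \<ge> 0"
  shows "majorized \<rho> (M ^ n) (\<lambda>x. g x ^ n)"
proof (induction n)
  case 0
  show ?case using majorized_const[OF assms(1), of "1::'b"] by simp
next
  case (Suc n)
  show ?case using majorized_mult[OF assms(1,2) Suc] assms(3) by simp
qed

lemma majorized_power_series:
  fixes g :: "real^'n \<Rightarrow> complex"
  assumes "\<rho> > 0" "majorized \<rho> M g" "M \<ge> 0"
    and "((\<lambda>n. norm (a n) * M ^ n) has_sum N) UNIV"
    and "\<And>z. norm z \<le> M \<Longrightarrow> ((\<lambda>n. a n * z ^ n) has_sum \<phi> z) UNIV"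
  shows "majorized \<rho> N (\<lambda>x. \<phi> (g x))"
proof (rule majorized_has_sum[OF assms(1) _ assms(4)])
  fix n
  show "majorized \<rho> (norm (a n) * M ^ n) (\<lambda>x. a n * g x ^ n)"
    using majorized_linear[OF bounded_linear_mult_right _ majorized_power[OF assms(1-3)] assms(1), of "a n" "norm (a n)"]
    by (simp add: norm_mult mult_ac)
qed (use assms majorized_norm_le in blast)

text \<open>Without a constant term every monomial has degree at least 1, so scaling the cube by
  \<open>l\<close> gains at least a factor \<open>l\<close>. This makes the norm as small as a disc
  of holomorphy requires.\<close>

lemma majorized_shrink:
  assumes "majorized \<rho> M g" "g 0 = 0" "\<rho> > 0" "0 < l" "l \<le> 1"
  shows "majorized (l * \<rho>) (l * M) g"
proof -
  obtain c N where c: "((\<lambda>\<alpha>. norm (c \<alpha>) * \<rho> ^ tdeg \<alpha>) has_sum N) UNIV" "N \<le> M"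
    "\<And>x. x \<in> cube \<rho> \<Longrightarrow> ((\<lambda>\<alpha>. mpow \<alpha> x *\<^sub>R c \<alpha>) has_sum g x) UNIV"
    by (rule majorizedE[OF assms(1)]) blast
  \<comment> \<open>At the origin only the constant monomial survives, so \<open>g 0 = 0\<close>
    kills its coefficient.\<close>
  have mpow0: "mpow \<alpha> (0::real^'a) = (if \<alpha> = (\<lambda>_. 0) then 1 else 0)" for \<alpha>
    by (auto simp: mpow_def fun_eq_iff)
  have "((\<lambda>\<alpha>. mpow \<alpha> 0 *\<^sub>R c \<alpha>) has_sum c (\<lambda>_. 0)) {\<lambda>_. 0}"
    by (auto intro!: has_sum_finiteI simp: mpow0)
  then have "((\<lambda>\<alpha>. mpow \<alpha> 0 *\<^sub>R c \<alpha>) has_sum c (\<lambda>_. 0)) UNIV"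
    by (rule has_sum_cong_neutral[THEN iffD1, rotated -1]) (auto simp: mpow0)
  moreover have "(0::real^'a) \<in> cube \<rho>" using assms by (simp add: cube_def)
  ultimately have c0: "c (\<lambda>_. 0) = 0"
    using c(3) assms(2) has_sum_unique by metis
  have le: "norm (c \<alpha>) * (l * \<rho>) ^ tdeg \<alpha> \<le> l * (norm (c \<alpha>) * \<rho> ^ tdeg \<alpha>)" for \<alpha>
  proof (cases "\<alpha> = (\<lambda>_. 0)")
    case False
    then have "tdeg \<alpha> > 0" unfolding tdeg_def by (subst neq0_conv[symmetric], subst sum_eq_0_iff) (auto simp: fun_eq_iff)
    then have "l ^ tdeg \<alpha> \<le> l" using assms power_decreasing[of 1 "tdeg \<alpha>" l] by simp
    then have "l ^ tdeg \<alpha> * (norm (c \<alpha>) * \<rho> ^ tdeg \<alpha>) \<le> l * (norm (c \<alpha>) * \<rho> ^ tdeg \<alpha>)"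
      using assms by (intro mult_right_mono) auto
    then show ?thesis by (simp add: power_mult_distrib mult_ac)
  qed (simp add: c0)
  have c': "((\<lambda>\<alpha>. l * (norm (c \<alpha>) * \<rho> ^ tdeg \<alpha>)) has_sum l * N) UNIV"
    by (rule has_sum_cmult_right[OF c(1)])
  have "l * N \<le> l * M" using c(2) assms by simp
  moreover have "cube (l * \<rho>) \<subseteq> (cube \<rho> :: (real^'a) set)"
    using assms by (intro cube_mono) simp
  ultimately show ?thesis
    using assms by (intro majorizedI_coeffs[OF _ le c']) (auto intro: c(3))
qed

section \<open>Germs at the origin with an absolutely convergent power series\<close>

definition analytic0 :: "(real^'n \<Rightarrow> 'b::banach) \<Rightarrow> bool" where
  "analytic0 g \<longleftrightarrow> (\<exists>\<rho>>0. \<exists>M. majorized \<rho> M g)"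

lemma analytic0I: "\<rho> > 0 \<Longrightarrow> majorized \<rho> M g \<Longrightarrow> analytic0 g"
  unfolding analytic0_def by blast

text \<open>Validity for all smaller radii lets two germs be placed on a common cube;
  \<open>M \<ge> 0\<close> serves the product rules.\<close>

lemma analytic0E:
  assumes "analytic0 g"
  obtains \<rho>0 M where "\<rho>0 > 0" "M \<ge> 0" "\<And>\<rho>. 0 < \<rho> \<Longrightarrow> \<rho> \<le> \<rho>0 \<Longrightarrow> majorized \<rho> M g"
proof -
  obtain \<rho> M where "\<rho> > 0" "majorized \<rho> M g" using assms unfolding analytic0_def by blast
  then show ?thesis
    by (intro that[of \<rho> "max M 0"]) (auto intro: majorized_mono)
qed

lemma eventually_cube:
  assumes "\<forall>\<^sub>F x in nhds 0. P x"
  obtains \<rho> where "\<rho> > 0" "\<And>x::real^'n. x \<in> cube \<rho> \<Longrightarrow> P x"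
proof -
  obtain e where e: "e > 0" "\<And>x. norm x < e \<Longrightarrow> P x"
    using assms unfolding eventually_nhds_metric by (auto simp: dist_norm)
  \<comment> \<open>The Euclidean norm is at most the sum of the absolute coordinates, hence at most
    \<open>e / 2\<close> on the cube chosen here.\<close>
  show ?thesis
  proof (rule that[of "e / (2 * CARD('n))"])
    fix x :: "real^'n" assume "x \<in> cube (e / (2 * CARD('n)))"
    then have "(\<Sum>i\<in>UNIV. \<bar>x$i\<bar>) \<le> CARD('n) * (e / (2 * CARD('n)))"
      by (intro sum_bounded_above) (auto simp: cube_def)
    also have "\<dots> < e" using e by (simp add: field_simps)
    finally show "P x" using e norm_le_l1_cart[of x] by simp
  qed (use e in auto)
qed

lemma analytic0_cong:
  assumes "analytic0 g" "\<forall>\<^sub>F x in nhds 0. g x = h x"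
  shows "analytic0 h"
proof -
  obtain \<rho>0 M where 1: "\<rho>0 > 0" "\<And>\<rho>. 0 < \<rho> \<Longrightarrow> \<rho> \<le> \<rho>0 \<Longrightarrow> majorized \<rho> M g"
    by (rule analytic0E[OF assms(1)]) blast
  obtain \<rho>1 where 2: "\<rho>1 > 0" "\<And>x. x \<in> cube \<rho>1 \<Longrightarrow> g x = h x"
    by (rule eventually_cube[OF assms(2)]) blast
  have "majorized (min \<rho>0 \<rho>1) M h"
    by (rule majorized_cong[OF 1(2)]) (use 1 2 cube_mono[of "min \<rho>0 \<rho>1" \<rho>1] in auto)
  then show ?thesis using 1 2 by (intro analytic0I[of "min \<rho>0 \<rho>1"]) auto
qed

lemma analytic0_const: "analytic0 (\<lambda>_. k)"
  by (rule analytic0I[OF zero_less_one majorized_const]) simp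

lemma analytic0_coord: "analytic0 (\<lambda>x. x$i)"
  by (rule analytic0I[OF zero_less_one majorized_coord]) simp

lemma analytic0_add:
  assumes "analytic0 g" "analytic0 h"
  shows "analytic0 (\<lambda>x. g x + h x)"
proof -
  obtain r M where 1: "r > 0" "\<And>\<rho>. 0 < \<rho> \<Longrightarrow> \<rho> \<le> r \<Longrightarrow> majorized \<rho> M g"
    by (rule analytic0E[OF assms(1)]) blast
  obtain r' M' where 2: "r' > 0" "\<And>\<rho>. 0 < \<rho> \<Longrightarrow> \<rho> \<le> r' \<Longrightarrow> majorized \<rho> M' h"
    by (rule analytic0E[OF assms(2)]) blast
  show ?thesis
    by (rule analytic0I[OF _ majorized_add[OF _ 1(2) 2(2)], of "min r r'"]) (use 1 2 in auto)
qed

lemma analytic0_bilinear: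
  assumes "bounded_bilinear p" "analytic0 g" "analytic0 h"
  shows "analytic0 (\<lambda>x. p (g x) (h x))"
proof -
  obtain r M where 1: "r > 0" "\<And>\<rho>. 0 < \<rho> \<Longrightarrow> \<rho> \<le> r \<Longrightarrow> majorized \<rho> M g"
    by (rule analytic0E[OF assms(2)]) blast
  obtain r' M' where 2: "r' > 0" "M' \<ge> 0" "\<And>\<rho>. 0 < \<rho> \<Longrightarrow> \<rho> \<le> r' \<Longrightarrow> majorized \<rho> M' h"
    by (rule analytic0E[OF assms(3)]) blast
  obtain K where "K \<ge> 0" "\<And>a b. norm (p a b) \<le> norm a * norm b * K"
    using bounded_bilinear.nonneg_bounded[OF assms(1)] by blast
  then show ?thesis
    by (intro analytic0I[OF _ majorized_bilinear[OF assms(1) _ _ _ 1(2) 2(3)], of "min r r'"])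
      (use 1 2 in auto)
qed

lemma analytic0_linear:
  assumes "bounded_linear T" "analytic0 g"
  shows "analytic0 (\<lambda>x. T (g x))"
proof -
  obtain r M where 1: "r > 0" "majorized r M g"
    by (rule analytic0E[OF assms(2)]) blast
  obtain K where "K \<ge> 0" "\<And>a. norm (T a) \<le> norm a * K"
    using bounded_linear.nonneg_bounded[OF assms(1)] by blast
  then show ?thesis
    using 1 by (intro analytic0I[OF 1(1) majorized_linear[OF assms(1)]])
qed

lemma analytic0_mult:
  fixes g h :: "real^'n \<Rightarrow> 'b::{banach,real_normed_algebra}"
  shows "analytic0 g \<Longrightarrow> analytic0 h \<Longrightarrow> analytic0 (\<lambda>x. g x * h x)"
  by (rule analytic0_bilinear[OF bounded_bilinear_mult])

lemma analytic0_minus: "analytic0 g \<Longrightarrow> analytic0 (\<lambda>x. - g x)"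
  by (rule analytic0_linear[OF bounded_linear_minus[OF bounded_linear_ident]])

lemma analytic0_diff: "analytic0 g \<Longrightarrow> analytic0 h \<Longrightarrow> analytic0 (\<lambda>x. g x - h x)"
  using analytic0_add[OF _ analytic0_minus] by fastforce

lemma analytic0_sum:
  "(\<And>k. k \<in> A \<Longrightarrow> analytic0 (g k)) \<Longrightarrow> analytic0 (\<lambda>x. \<Sum>k\<in>A. g k x)"
  by (induction A rule: infinite_finite_induct) (auto intro: analytic0_const analytic0_add)

lemma vec_eq_sum_axis: "x = (\<Sum>j\<in>UNIV. x$j *\<^sub>R axis j 1)" for x :: "real^'n"
  using basis_expansion[of x] by (simp add: scalar_mult_eq_scaleR)

lemma analytic0_ident: "analytic0 (\<lambda>x::real^'n. x)"
proof -
  have "(\<lambda>x::real^'n. \<Sum>j\<in>UNIV. x$j *\<^sub>R (axis j 1 :: real^'n)) = (\<lambda>x. x)"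
    by (rule ext) (rule vec_eq_sum_axis[symmetric])
  moreover have "analytic0 (\<lambda>x::real^'n. \<Sum>j\<in>UNIV. x$j *\<^sub>R (axis j 1 :: real^'n))"
    by (intro analytic0_sum analytic0_bilinear[OF bounded_bilinear_scaleR] analytic0_coord analytic0_const)
  ultimately show ?thesis by simp
qed

lemma holomorphic_has_sum:
  assumes "f holomorphic_on ball c e" "norm z < e"
  shows "((\<lambda>n. (deriv ^^ n) f c / fact n * z ^ n) has_sum f (c + z)) UNIV"
    and "summable (\<lambda>n. norm ((deriv ^^ n) f c / fact n) * norm z ^ n)"
proof -
  have ps: "(\<lambda>n. (deriv ^^ n) f c / fact n * w ^ n) sums f (c + w)" if "norm w < e" for w
    using holomorphic_power_series[OF assms(1), of "c + w"] that by (simp add: dist_norm)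
  \<comment> \<open>Convergence at a strictly larger radius gives absolute convergence at
    \<open>norm z\<close>, which the unordered sum needs.\<close>
  obtain r where r: "norm z < r" "r < e" using assms(2) dense by blast
  then have "summable (\<lambda>n. (deriv ^^ n) f c / fact n * (of_real r :: complex) ^ n)"
    using ps[of "of_real r"] order_le_less_trans[OF norm_ge_zero r(1)] by (auto simp: sums_iff)
  then have *: "summable (\<lambda>n. norm ((deriv ^^ n) f c / fact n * z ^ n))"
    by (rule powser_insidea) (use r in auto)
  show "((\<lambda>n. (deriv ^^ n) f c / fact n * z ^ n) has_sum f (c + z)) UNIV"
    by (rule norm_summable_imp_has_sum[OF * ps[OF assms(2)]])
  show "summable (\<lambda>n. norm ((deriv ^^ n) f c / fact n) * norm z ^ n)"
    using * by (simp add: norm_mult norm_power norm_divide)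
qed

text \<open>The Taylor series of \<open>f\<close> at \<open>g 0\<close> is composed with
  \<open>g - g 0\<close>, after shrinking the cube until the norm of that difference lies below
  \<open>e\<close>.\<close>

lemma analytic0_holomorphic:
  fixes g :: "real^'n \<Rightarrow> complex"
  assumes "analytic0 g" "f holomorphic_on ball (g 0) e" "e > 0"
  shows "analytic0 (\<lambda>x. f (g x))"
proof -
  define h where "h x = g x - g 0" for x
  have "analytic0 h" unfolding h_def by (intro analytic0_diff assms analytic0_const)
  then obtain \<rho> M0 where 1: "\<rho> > 0" "M0 \<ge> 0" "majorized \<rho> M0 h"
    by (rule analytic0E) blast
  \<comment> \<open>Chosen so that \<open>l * M0 < e\<close>; the \<open>+ 1\<close> covers
    \<open>M0 = 0\<close>.\<close>
  define l where "l = min 1 (e / (2 * (M0 + 1)))"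
  define M where "M = l * M0"
  have l: "0 < l" "l \<le> 1" using assms(3) 1 by (auto simp: l_def)
  have M0: "M \<ge> 0" using l 1 by (simp add: M_def)
  have "M \<le> e / (2 * (M0 + 1)) * M0"
    unfolding M_def l_def using 1 by (intro mult_right_mono) auto
  also have "\<dots> < e" using assms(3) 1 by (simp add: field_simps add_nonneg_pos)
  finally have "M < e" .
  have maj: "majorized (l * \<rho>) M h"
    unfolding M_def by (rule majorized_shrink[OF 1(3) _ 1(1) l]) (simp add: h_def)
  define a where "a n = (deriv ^^ n) f (g 0) / fact n" for n
  have "summable (\<lambda>n. norm (a n) * M ^ n)"
    using holomorphic_has_sum(2)[OF assms(2), of "of_real M"] M0 \<open>M < e\<close> by (simp add: a_def)
  then have sN: "(\<lambda>n. norm (a n) * M ^ n) summable_on UNIV"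
    by (rule summable_nonneg_imp_summable_on) (use M0 in auto)
  have "majorized (l * \<rho>) (\<Sum>\<^sub>\<infinity>n. norm (a n) * M ^ n) (\<lambda>x. f (g 0 + h x))"
  proof (rule majorized_power_series[OF _ maj M0 has_sum_infsum[OF sN]])
    show "((\<lambda>n. a n * z ^ n) has_sum f (g 0 + z)) UNIV" if "norm z \<le> M" for z
      using holomorphic_has_sum(1)[OF assms(2), of z] that \<open>M < e\<close> by (simp add: a_def)
  qed (use 1 l in auto)
  then show ?thesis
    using 1 l by (intro analytic0I[of "l * \<rho>"]) (auto simp: h_def)
qed

lemma real_analytic_on_analytic0:
  assumes "open S" "\<And>a. a \<in> S \<Longrightarrow> analytic0 (\<lambda>x. f (a + x))"
  shows "real_analytic_on f S"
  unfolding real_analytic_on_def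
proof
  fix a assume a: "a \<in> S"
  obtain \<rho> M where 1: "\<rho> > 0" "majorized \<rho> M (\<lambda>x. f (a + x))"
    using assms(2)[OF a] unfolding analytic0_def by blast
  obtain c N where c: "\<And>x. x \<in> cube \<rho> \<Longrightarrow> ((\<lambda>\<alpha>. mpow \<alpha> x *\<^sub>R c \<alpha>) has_sum f (a + x)) UNIV"
    by (rule majorizedE[OF 1(2)]) blast
  obtain e where e: "e > 0" "ball a e \<subseteq> S" using assms(1) a open_contains_ball by blast
  show "\<exists>r>0. \<exists>c. \<forall>x\<in>ball a r. x \<in> S \<and>
       ((\<lambda>\<alpha>. (\<Prod>i\<in>UNIV. (x$i - a$i) ^ (\<alpha> i)) *\<^sub>R c \<alpha>) has_sum f x) UNIV"
  proof (intro exI[of _ "min \<rho> e"] conjI exI[of _ c] ballI)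
    fix x assume x: "x \<in> ball a (min \<rho> e)"
    then show "x \<in> S" using e by auto
    have "norm (x - a) < \<rho>" using x by (simp add: dist_norm norm_minus_commute)
    then have "x - a \<in> cube \<rho>"
      unfolding cube_def using component_le_norm_cart[of "x - a"] by (auto intro: order_trans less_imp_le)
    from c[OF this] show "((\<lambda>\<alpha>. (\<Prod>i\<in>UNIV. (x$i - a$i) ^ (\<alpha> i)) *\<^sub>R c \<alpha>) has_sum f x) UNIV"
      by (simp add: mpow_def)
  qed (use 1 e in auto)
qed

section \<open>The holomorphic primitive\<close>

text \<open>The equation w_t = - u_r is built into the derivative of \<open>w\<close> and makes w dr
  - u dt closed. Continuity of the partial derivatives serves to differentiate the potential under
  the integral. The last conclusion recovers \<open>u\<close> on the real axis, where the formula
  for \<open>Im z * u z\<close> is void.\<close>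

lemma slice_primitive:
  fixes u w ut ur wr :: "complex \<Rightarrow> real"
  assumes u: "\<And>z. z \<in> ball z0 e \<Longrightarrow> (u has_derivative (\<lambda>h. Re h * ut z + Im h * ur z)) (at z)"
    and w: "\<And>z. z \<in> ball z0 e \<Longrightarrow> (w has_derivative (\<lambda>h. Im h * wr z - Re h * ur z)) (at z)"
    and cont: "continuous_on (ball z0 e) ut" "continuous_on (ball z0 e) ur" "continuous_on (ball z0 e) wr"
    and eq: "\<And>z. z \<in> ball z0 e \<Longrightarrow> Im z * ut z = Im z * wr z + 2 * w z"
  obtains K where "K holomorphic_on ball z0 e"
    "\<And>z. z \<in> ball z0 e \<Longrightarrow> Im z * u z = - Im (deriv K z)"
    "\<And>z. z \<in> ball z0 e \<Longrightarrow> (Im z)\<^sup>2 * w z = Im z * Re (deriv K z) - Im (K z)"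
    "\<And>z. z \<in> ball z0 e \<Longrightarrow> Im z = 0 \<Longrightarrow> deriv (deriv K) z = - of_real (u z)"
proof -
  let ?B = "ball z0 e"
  define p where "p z l = z0 + of_real l * (z - z0)" for z :: complex and l :: real
  define f where "f z l = w (p z l) * Im (z - z0) - u (p z l) * Re (z - z0)" for z l
  \<comment> \<open>\<open>A\<close> and \<open>B\<close> are the partial derivatives of
    \<open>f z l\<close> in Re z and Im z. By closedness they are also the
    \<open>l\<close>-derivatives of \<open>- (l * u (p z l))\<close> and
    \<open>l * w (p z l)\<close>, so their integrals over the unit interval are \<open>- u z\<close>
    and \<open>w z\<close>.\<close>
  define A where "A z l = - u (p z l) - l * (Re (z - z0) * ut (p z l) + Im (z - z0) * ur (p z l))" for z l
  define B where "B z l = w (p z l) + l * (Im (z - z0) * wr (p z l) - Re (z - z0) * ur (p z l))" for z l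
  \<comment> \<open>the potential of the closed form \<open>w dr - u dt\<close>, integrated along rays from \<open>z0\<close>\<close>
  define s where "s z = integral (cbox 0 1) (f z)" for z
  have pB: "p z l \<in> ?B" if "z \<in> ?B" "l \<in> cbox 0 1" for z l
  proof -
    have "norm (of_real l * (z - z0)) \<le> 1 * norm (z - z0)"
      unfolding norm_mult using that by (intro mult_right_mono) auto
    then show ?thesis using that(1) by (simp add: p_def dist_norm norm_minus_commute)
  qed
  have contu: "continuous_on ?B u" and contw: "continuous_on ?B w"
    using u w by (meson has_derivative_continuous continuous_at_imp_continuous_on)+
  have contp: "continuous_on (?B \<times> cbox 0 1) (\<lambda>x. p (fst x) (snd x))"
    unfolding p_def by (intro continuous_intros)
  have pim: "(\<lambda>x. p (fst x) (snd x)) ` (?B \<times> cbox 0 1) \<subseteq> ?B" using pB by auto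
  have comp: "continuous_on (?B \<times> cbox 0 1) (\<lambda>x. g (p (fst x) (snd x)))"
    if "continuous_on ?B g" for g :: "complex \<Rightarrow> real"
    by (rule continuous_on_compose2[OF that contp pim])
  have contA: "continuous_on (?B \<times> cbox 0 1) (\<lambda>x. A (fst x) (snd x))"
    unfolding A_def by (intro continuous_intros comp cont contu)
  have contB: "continuous_on (?B \<times> cbox 0 1) (\<lambda>x. B (fst x) (snd x))"
    unfolding B_def by (intro continuous_intros comp cont contw)
  have contf: "continuous_on (?B \<times> cbox 0 1) (\<lambda>x. f (fst x) (snd x))"
    unfolding f_def by (intro continuous_intros comp contu contw)
  define fx where "fx z l = A z l *\<^sub>R Blinfun Re + B z l *\<^sub>R Blinfun Im" for z l
  have fx_apply: "blinfun_apply (fx z l) h = A z l * Re h + B z l * Im h" for z l h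
    unfolding fx_def
    by (simp add: blinfun.add_left blinfun.scaleR_left bounded_linear_Blinfun_apply bounded_linear_Re bounded_linear_Im)
  have dp: "((\<lambda>z. p z l) has_derivative (\<lambda>h. of_real l * h)) (at z)" for z l
    unfolding p_def by (auto intro!: derivative_eq_intros)
  have df: "((\<lambda>z. f z l) has_derivative blinfun_apply (fx z l)) (at z within ?B)"
    if "z \<in> ?B" "l \<in> cbox 0 1" for z l
  proof (rule has_derivative_at_withinI)
    note [derivative_intros] = has_derivative_compose[OF dp u[OF pB[OF that]]]
      has_derivative_compose[OF dp w[OF pB[OF that]]]
    show "((\<lambda>z. f z l) has_derivative blinfun_apply (fx z l)) (at z)"
      unfolding f_def by (auto intro!: derivative_eq_intros ext simp: fx_apply A_def B_def algebra_simps)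
  qed
  have dpl: "((\<lambda>l. p z l) has_derivative (\<lambda>h. of_real h * (z - z0))) (at l)" for z l
    unfolding p_def by (auto intro!: derivative_eq_intros)
  have intA: "(A z has_integral - u z) (cbox 0 1)" if z: "z \<in> ?B" for z
  proof -
    have "(A z has_integral (- (1 * u (p z 1))) - (- (0 * u (p z 0)))) {0..1}"
    proof (rule fundamental_theorem_of_calculus)
      fix l :: real assume "l \<in> {0..1}"
      then have l: "l \<in> cbox 0 1" by simp
      note [derivative_intros] = has_derivative_compose[OF dpl u[OF pB[OF z l]]]
      show "((\<lambda>l. - (l * u (p z l))) has_vector_derivative A z l) (at l within {0..1})"
        unfolding has_vector_derivative_def A_def
        by (rule has_derivative_at_withinI, rule has_derivative_eq_rhs, (rule derivative_intros)+)
          (auto simp: fun_eq_iff algebra_simps)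
    qed simp
    then show ?thesis by (simp add: p_def)
  qed
  have intB: "(B z has_integral w z) (cbox 0 1)" if z: "z \<in> ?B" for z
  proof -
    have "(B z has_integral (1 * w (p z 1)) - (0 * w (p z 0))) {0..1}"
    proof (rule fundamental_theorem_of_calculus)
      fix l :: real assume "l \<in> {0..1}"
      then have l: "l \<in> cbox 0 1" by simp
      note [derivative_intros] = has_derivative_compose[OF dpl w[OF pB[OF z l]]]
      show "((\<lambda>l. l * w (p z l)) has_vector_derivative B z l) (at l within {0..1})"
        unfolding has_vector_derivative_def B_def
        by (rule has_derivative_at_withinI, rule has_derivative_eq_rhs, (rule derivative_intros)+)
          (auto simp: fun_eq_iff algebra_simps)
    qed simp
    then show ?thesis by (simp add: p_def)
  qed
  have ds: "(s has_derivative (\<lambda>h. w z * Im h - u z * Re h)) (at z)" if z: "z \<in> ?B" for z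
  proof -
    have "(s has_derivative blinfun_apply (integral (cbox 0 1) (fx z))) (at z within ?B)"
      unfolding s_def
    proof (rule leibniz_rule[OF df])
      show "f x integrable_on cbox 0 1" if "x \<in> ?B" for x
      proof (rule integrable_continuous)
        have "continuous_on (cbox 0 1) (\<lambda>l. f (fst (x, l)) (snd (x, l)))"
          by (rule continuous_on_compose2[OF contf]) (use that in \<open>auto intro!: continuous_intros\<close>)
        then show "continuous_on (cbox 0 1) (f x)" by simp
      qed
      show "continuous_on (?B \<times> cbox 0 1) (\<lambda>(x, t). fx x t)"
        unfolding fx_def case_prod_beta by (intro continuous_intros contA contB)
    qed (use z in auto)
    moreover have "(fx z has_integral (- u z) *\<^sub>R Blinfun Re + w z *\<^sub>R Blinfun Im) (cbox 0 1)"
      unfolding fx_def by (intro has_integral_add has_integral_scaleR_left intA intB z)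
    ultimately have "(s has_derivative blinfun_apply ((- u z) *\<^sub>R Blinfun Re + w z *\<^sub>R Blinfun Im)) (at z within ?B)"
      by (simp add: integral_unique)
    also have "blinfun_apply ((- u z) *\<^sub>R Blinfun Re + w z *\<^sub>R Blinfun Im) = (\<lambda>h. w z * Im h - u z * Re h)"
      by (rule ext)
        (simp add: blinfun.add_left blinfun.diff_left blinfun.scaleR_left blinfun.minus_left bounded_linear_Blinfun_apply bounded_linear_Re bounded_linear_Im)
    finally show ?thesis using z by (simp add: at_within_open[OF _ open_ball])
  qed
  \<comment> \<open>\<open>- \<i>\<close> times the holomorphic function \<open>r u + \<i> (r w + s)\<close>\<close>
  define k where "k z = of_real (Im z * w z + s z) - \<i> * of_real (Im z * u z)" for z
  \<comment> \<open>The derivative of \<open>k\<close> in the real direction. In the imaginary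
    direction it is 2 w + r wr - i (u + r ur), which \<open>eq\<close> turns into i times
    \<open>k'\<close>.\<close>
  define k' where "k' z = of_real (- Im z * ur z - u z) - \<i> * of_real (Im z * ut z)" for z
  have dk: "(k has_field_derivative k' z) (at z)" if z: "z \<in> ?B" for z
  proof -
    note [derivative_intros] = u[OF z] w[OF z] ds[OF z]
    have *: "Im z * (Im h * wr z) + 2 * (Im h * w z) = Im z * (Im h * ut z)" for h
      using arg_cong[OF eq[OF z], of "\<lambda>t. Im h * t"] by (simp add: algebra_simps)
    show ?thesis
      unfolding has_field_derivative_def k_def k'_def
      by (rule derivative_eq_intros refl)+
        (auto simp: fun_eq_iff complex_eq_iff algebra_simps *[simplified algebra_simps])
  qed
  then have "k holomorphic_on ?B"
    unfolding holomorphic_on_open[OF open_ball] by blast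
  then obtain K1 where "\<And>z. z \<in> ?B \<Longrightarrow> (K1 has_field_derivative k z) (at z within ?B)"
    using holomorphic_convex_primitive'[of ?B k] by auto
  then have K1: "(K1 has_field_derivative k z) (at z)" if "z \<in> ?B" for z
    using that by (simp add: at_within_open[OF _ open_ball])
  \<comment> \<open>Both terms have differential - r u dt + (r w + s) dr, so they differ by a
    constant; removing it in \<open>K\<close> gives Im K = r s exactly.\<close>
  have "((\<lambda>z. Im (K1 z) - Im z * s z) has_derivative (\<lambda>h. 0)) (at z within ?B)" if z: "z \<in> ?B" for z
  proof (rule has_derivative_at_withinI)
    note [derivative_intros] = K1[OF z, unfolded has_field_derivative_def] ds[OF z]
    show "((\<lambda>z. Im (K1 z) - Im z * s z) has_derivative (\<lambda>h. 0)) (at z)"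
      by (rule derivative_eq_intros refl)+ (auto simp: k_def fun_eq_iff algebra_simps)
  qed
  then have "\<exists>c. \<forall>z\<in>?B. Im (K1 z) - Im z * s z = c"
    by (rule has_derivative_zero_constant[OF convex_ball])
  then obtain c where c: "\<And>z. z \<in> ?B \<Longrightarrow> Im (K1 z) - Im z * s z = c" by blast
  define K where "K z = K1 z - \<i> * of_real c" for z
  have dK: "(K has_field_derivative k z) (at z)" if "z \<in> ?B" for z
    unfolding K_def using K1[OF that] by (auto intro!: derivative_eq_intros)
  then have dK': "deriv K z = k z" if "z \<in> ?B" for z
    using that by (intro DERIV_imp_deriv) auto
  show ?thesis
  proof (rule that[of K])
    show "K holomorphic_on ?B"
      using dK unfolding holomorphic_on_open[OF open_ball] by blast
    show "Im z * u z = - Im (deriv K z)" if "z \<in> ?B" for z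
      by (simp add: dK'[OF that] k_def)
    show "(Im z)\<^sup>2 * w z = Im z * Re (deriv K z) - Im (K z)" if "z \<in> ?B" for z
      using c[OF that] by (simp add: dK'[OF that] k_def K_def algebra_simps power2_eq_square)
    show "deriv (deriv K) z = - of_real (u z)" if z: "z \<in> ?B" "Im z = 0" for z
    proof -
      have "(deriv K has_field_derivative k' z) (at z)"
        by (rule has_field_derivative_transform_within_open[OF dk[OF z(1)] open_ball z(1)]) (simp add: dK')
      then show ?thesis using z(2) by (simp add: DERIV_imp_deriv k'_def)
    qed
  qed
qed

text \<open>At a real point the complex derivative is the derivative along the real axis, where by
  induction the function takes real values.\<close>

lemma Im_higher_deriv_eq_0:
  assumes "K holomorphic_on ball c e" "\<And>z. z \<in> ball c e \<Longrightarrow> Im z = 0 \<Longrightarrow> Im (K z) = 0"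
    and "z \<in> ball c e" "Im z = 0"
  shows "Im ((deriv ^^ n) K z) = 0"
  using assms(3,4)
proof (induction n arbitrary: z)
  case 0
  then show ?case using assms(2) by simp
next
  case (Suc n)
  let ?f = "(deriv ^^ n) K"
  have "?f holomorphic_on ball c e"
    by (rule holomorphic_higher_deriv[OF assms(1) open_ball])
  then have d: "(?f has_field_derivative deriv ?f z) (at z)"
    using Suc.prems holomorphic_derivI by blast
  have z: "z = of_real (Re z)" using Suc.prems by (simp add: complex_eq_iff)
  have "((\<lambda>t. Im (?f (of_real t))) has_derivative (\<lambda>h. Im (deriv ?f z * of_real h))) (at (Re z))"
    by (rule bounded_linear.has_derivative[OF bounded_linear_Im]
        has_derivative_compose[OF bounded_linear.has_derivative[OF bounded_linear_of_real has_derivative_ident]])+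
      (use d z in \<open>simp add: has_field_derivative_def\<close>)
  moreover have "((\<lambda>t. Im (?f (of_real t))) has_derivative (\<lambda>h. 0)) (at (Re z))"
  proof (rule has_derivative_transform_within_open[OF has_derivative_const[of 0]])
    show "open ((of_real :: real \<Rightarrow> complex) -` ball c e)"
      by (intro open_vimage open_ball continuous_intros)
    show "Re z \<in> of_real -` ball c e" using Suc.prems z by simp
    show "0 = Im (?f (of_real t))" if "t \<in> of_real -` ball c e" for t
      using that Suc.IH[of "of_real t"] by simp
  qed
  ultimately have "(\<lambda>h. Im (deriv ?f z * of_real h)) = (\<lambda>h. 0)"
    by (rule has_derivative_unique)
  from fun_cong[OF this, of 1] show ?case by simp
qed

section \<open>Analyticity in the octonionic variable\<close>

definition imsq :: "real^8 \<Rightarrow> real" where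
  "imsq x = (\<Sum>i\<in>-{0}. (x$i)\<^sup>2)"

definition imnorm :: "real^8 \<Rightarrow> real" where
  "imnorm x = sqrt (imsq x)"

text \<open>The point of the closed upper half plane that stands for the whole sphere of octonions
  sharing the real part and the imaginary norm of \<open>x\<close>.\<close>

definition cpoint :: "real^8 \<Rightarrow> complex" where
  "cpoint x = Complex (x$0) (imnorm x)"

lemma imsq_nonneg: "imsq x \<ge> 0"
  unfolding imsq_def by (intro sum_nonneg) auto

lemma imnorm_nonneg: "imnorm x \<ge> 0"
  unfolding imnorm_def using imsq_nonneg by simp

lemma imnorm_power2: "(imnorm x)\<^sup>2 = imsq x"
  unfolding imnorm_def using imsq_nonneg by simp

lemma continuous_imnorm: "continuous_on S imnorm"
  unfolding imnorm_def[abs_def] imsq_def by (intro continuous_intros)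

lemma cpoint_eq: "cpoint x = of_real (x$0) + \<i> * of_real (imnorm x)"
  by (simp add: cpoint_def complex_eq_iff)

lemma continuous_cpoint: "continuous_on S cpoint"
  unfolding cpoint_eq[abs_def] by (intro continuous_intros continuous_imnorm)

section \<open>Polynomials in the real part and the squared imaginary norm, with majorants\<close>

lemma has_sum_Suc_iff:
  fixes f :: "nat \<Rightarrow> 'a::{comm_monoid_add,topological_space}"
  assumes "f 0 = 0"
  shows "((\<lambda>n. f (Suc n)) has_sum S) UNIV \<longleftrightarrow> (f has_sum S) UNIV"
proof -
  have "((\<lambda>n. f (Suc n)) has_sum S) UNIV \<longleftrightarrow> (f has_sum S) (range Suc)"
    by (simp add: has_sum_reindex o_def)
  also have "\<dots> \<longleftrightarrow> (f has_sum S) UNIV"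
    by (rule has_sum_cong_neutral) (use assms in \<open>auto simp: image_iff\<close>, metis not0_implies_Suc)
  finally show ?thesis .
qed

text \<open>
  With \<open>y = r\<^sup>2\<close>, one has \<open>(\<tau> + \<i> r) ^ n = Tpoly n \<tau> y + \<i> r Spoly n \<tau> y\<close>, and
  \<open>Vpoly n\<close> is the polynomial \<open>(n Tpoly (n - 1) - Spoly n) / y\<close>.
\<close>

fun Tpoly Spoly :: "nat \<Rightarrow> real \<Rightarrow> real \<Rightarrow> real" where
  "Tpoly 0 \<tau> y = 1"
| "Tpoly (Suc n) \<tau> y = \<tau> * Tpoly n \<tau> y + - 1 * (y * Spoly n \<tau> y)"
| "Spoly 0 \<tau> y = 0"
| "Spoly (Suc n) \<tau> y = Tpoly n \<tau> y + \<tau> * Spoly n \<tau> y"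

fun Vpoly :: "nat \<Rightarrow> real \<Rightarrow> real \<Rightarrow> real" where
  "Vpoly 0 \<tau> y = 0"
| "Vpoly (Suc n) \<tau> y = \<tau> * Vpoly n \<tau> y + - real n * Spoly (n - 1) \<tau> y"

lemma Complex_power: "Complex \<tau> r ^ n = Complex (Tpoly n \<tau> (r\<^sup>2)) (r * Spoly n \<tau> (r\<^sup>2))"
  by (induction n) (simp_all add: complex_eq_iff algebra_simps power2_eq_square)

text \<open>For positive \<open>n\<close>, both terms on the right equal n \<tau>^(n-1) at
  \<open>y = 0\<close>, hence the divisibility by \<open>y\<close>. The recursion of
  \<open>Vpoly\<close> is the one satisfied by the right-hand side, divided by
  \<open>y\<close>.\<close>

lemma Vpoly_mult: "y * Vpoly n \<tau> y = real n * Tpoly (n - 1) \<tau> y - Spoly n \<tau> y"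
proof (induction n)
  case (Suc n)
  have "y * Vpoly (Suc n) \<tau> y = \<tau> * (y * Vpoly n \<tau> y) - real n * y * Spoly (n - 1) \<tau> y"
    by (simp add: algebra_simps)
  also have "\<dots> = \<tau> * (real n * Tpoly (n - 1) \<tau> y - Spoly n \<tau> y) - real n * y * Spoly (n - 1) \<tau> y"
    by (simp only: Suc)
  \<comment> \<open>For positive \<open>n\<close> the recursion of \<open>Tpoly\<close> combines the
    terms carrying the factor \<open>n\<close>; for \<open>n = 0\<close> that factor cancels the
    truncated index \<open>n - 1\<close>.\<close>
  also have "\<dots> = real (Suc n) * Tpoly (Suc n - 1) \<tau> y - Spoly (Suc n) \<tau> y"
    by (cases n) (simp_all add: algebra_simps)
  finally show ?case .
qed simp

lemma Spoly_zero: "Spoly (Suc n) \<tau> 0 = real (Suc n) * \<tau> ^ n"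
proof -
  have T: "Tpoly n \<tau> 0 = \<tau> ^ n" for n by (induction n) auto
  show ?thesis by (induction n) (auto simp: T algebra_simps)
qed

context
  fixes \<rho> :: real and \<tau> y :: "real^'n \<Rightarrow> real"
  assumes \<rho>: "\<rho> > 0" and \<tau>: "majorized \<rho> \<rho> \<tau>" and y: "majorized \<rho> (9 * \<rho>\<^sup>2) y"
begin

text \<open>With signs ignored, \<tau> counts as \<rho> and r as 3 \<rho>, the root of the bound on
  \<open>y\<close>. So the powers of \<tau> + i r are bounded by those of \<rho> + 3 \<rho>;
  \<open>Spoly\<close> loses a factor 3 \<rho> because it occurs multiplied by r. The recursions are
  written as sums, with a factor \<open>- 1\<close>, to fit the closure rules.\<close>

lemma majorized_Tpoly_Spoly:
  "majorized \<rho> ((4 * \<rho>) ^ n) (\<lambda>x. Tpoly n (\<tau> x) (y x)) \<and>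
   majorized \<rho> ((4 * \<rho>) ^ n / (3 * \<rho>)) (\<lambda>x. Spoly n (\<tau> x) (y x))"
proof (induction n)
  case 0
  have "majorized \<rho> 1 (\<lambda>x::real^'n. 1::real)" using majorized_const[OF \<rho>, of "1::real"] by simp
  then show ?case using \<rho> by (auto intro!: majorized_zero)
next
  case (Suc n)
  have T: "\<rho> * (4 * \<rho>) ^ n + \<bar>- 1\<bar> * (9 * \<rho>\<^sup>2 * ((4 * \<rho>) ^ n / (3 * \<rho>))) = (4 * \<rho>) ^ Suc n"
    and S: "(4 * \<rho>) ^ n + \<rho> * ((4 * \<rho>) ^ n / (3 * \<rho>)) = (4 * \<rho>) ^ Suc n / (3 * \<rho>)"
    using \<rho> by (simp_all add: field_simps power2_eq_square)
  have "majorized \<rho> (\<rho> * (4 * \<rho>) ^ n + \<bar>- 1\<bar> * (9 * \<rho>\<^sup>2 * ((4 * \<rho>) ^ n / (3 * \<rho>)))) (\<lambda>x. Tpoly (Suc n) (\<tau> x) (y x))"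
    unfolding Tpoly.simps using Suc \<rho> \<tau> y
    by (intro majorized_add[OF \<rho> majorized_mult majorized_cmult[OF \<rho> majorized_mult]]) auto
  moreover have "majorized \<rho> ((4 * \<rho>) ^ n + \<rho> * ((4 * \<rho>) ^ n / (3 * \<rho>))) (\<lambda>x. Spoly (Suc n) (\<tau> x) (y x))"
    unfolding Spoly.simps using Suc \<rho> \<tau>
    by (intro majorized_add[OF \<rho> _ majorized_mult]) auto
  ultimately show ?case unfolding T S by blast
qed

text \<open>The factor \<open>n\<close> in the recursion costs a doubling of the base, by n < 2^n.
  The division by \<open>\<rho> ^ 3\<close> reflects homogeneity: \<open>Vpoly n\<close> has degree
  n - 3 in \<tau> and r.\<close>

lemma majorized_Vpoly: "majorized \<rho> ((8 * \<rho>) ^ n / \<rho> ^ 3) (\<lambda>x. Vpoly n (\<tau> x) (y x))"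
proof (induction n)
  case 0
  show ?case using \<rho> by (auto intro!: majorized_zero)
next
  case (Suc n)
  have V: "majorized \<rho> (\<rho> * ((8 * \<rho>) ^ n / \<rho> ^ 3) + \<bar>- real n\<bar> * ((4 * \<rho>) ^ (n - 1) / (3 * \<rho>)))
      (\<lambda>x. Vpoly (Suc n) (\<tau> x) (y x))"
    unfolding Vpoly.simps using Suc \<rho> \<tau> majorized_Tpoly_Spoly
    by (intro majorized_add[OF \<rho> majorized_mult majorized_cmult]) auto
  have le: "\<rho> * ((8 * \<rho>) ^ n / \<rho> ^ 3) + \<bar>- real n\<bar> * ((4 * \<rho>) ^ (n - 1) / (3 * \<rho>)) \<le> (8 * \<rho>) ^ Suc n / \<rho> ^ 3"
  proof (cases n)
    case 0
    then show ?thesis using \<rho> by (simp add: field_simps power2_eq_square power3_eq_cube)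
  next
    case (Suc m)
    have "real n < 2 ^ n" by (rule of_nat_less_two_power)
    then have "real n * (4 * \<rho>) ^ n \<le> 2 ^ n * (4 * \<rho>) ^ n"
      using \<rho> by (intro mult_right_mono) auto
    also have "\<dots> = (2 * (4 * \<rho>)) ^ n" by (rule power_mult_distrib[symmetric])
    also have "2 * (4 * \<rho>) = 8 * \<rho>" by simp
    finally have *: "real n * (4 * \<rho>) ^ n \<le> (8 * \<rho>) ^ n" .
    have "\<bar>- real n\<bar> * ((4 * \<rho>) ^ (n - 1) / (3 * \<rho>)) = real n * (4 * \<rho>) ^ n / (12 * \<rho>\<^sup>2)"
      using \<rho> Suc by (simp add: field_simps power2_eq_square)
    also have "\<dots> \<le> (8 * \<rho>) ^ n / (12 * \<rho>\<^sup>2)"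
      using * \<rho> by (intro divide_right_mono) auto
    also have "\<dots> \<le> (8 * \<rho>) ^ n / \<rho>\<^sup>2"
      using \<rho> by (intro divide_left_mono) auto
    finally have "\<rho> * ((8 * \<rho>) ^ n / \<rho> ^ 3) + \<bar>- real n\<bar> * ((4 * \<rho>) ^ (n - 1) / (3 * \<rho>))
        \<le> \<rho> * ((8 * \<rho>) ^ n / \<rho> ^ 3) + (8 * \<rho>) ^ n / \<rho>\<^sup>2" by simp
    also have "\<dots> \<le> (8 * \<rho>) ^ Suc n / \<rho> ^ 3"
      using \<rho> by (simp add: field_simps power2_eq_square power3_eq_cube)
    finally show ?thesis .
  qed
  show ?case
    by (rule majorized_mono[OF V \<rho> order_refl le])
qed

end

text \<open>Seven squares contribute 7 \<rho>^2; the bound is rounded up to a perfect square, whose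
  root enters the estimate of \<open>Spoly\<close>.\<close>

lemma majorized_imsq: "\<rho> > 0 \<Longrightarrow> majorized \<rho> (9 * \<rho>\<^sup>2) (imsq :: real^8 \<Rightarrow> real)"
proof -
  assume \<rho>: "\<rho> > 0"
  have "majorized \<rho> (\<Sum>i\<in>(UNIV::8 set). \<rho>\<^sup>2) (\<lambda>x::real^8. \<Sum>i\<in>UNIV. if i = 0 then 0 else (x$i)\<^sup>2)"
  proof (rule majorized_sum[OF \<rho>])
    fix i :: 8
    show "majorized \<rho> (\<rho>\<^sup>2) (\<lambda>x. if i = 0 then 0 else (x$i)\<^sup>2)"
    proof (cases "i = 0")
      case True
      then show ?thesis using majorized_zero[OF \<rho>, of "\<rho>\<^sup>2"] by simp
    next
      case False
      then show ?thesis using majorized_power[OF \<rho> majorized_coord[OF \<rho>], of 2 i] \<rho> by simp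
    qed
  qed
  moreover have "(\<Sum>i\<in>UNIV. if i = 0 then 0 else (x$i)\<^sup>2) = imsq x" for x :: "real^8"
    unfolding imsq_def by (rule sum.mono_neutral_cong_right) auto
  ultimately have "majorized \<rho> (8 * \<rho>\<^sup>2) (\<lambda>x. imsq x)" by simp
  then show ?thesis by (rule majorized_mono) (use \<rho> in auto)
qed

text \<open>The identities for r u and r^2 w are compared termwise with the Taylor series of
  \<open>K\<close> and its derivative. They determine u and w only for r different from 0; on the
  axis \<open>u0\<close> and \<open>w0\<close> take over.\<close>

lemma slice_analytic_real_point:
  fixes u w :: "complex \<Rightarrow> real" and a :: "real^8"
  assumes e: "e > 0" and K: "K holomorphic_on ball (cpoint a) e"
    and u: "\<And>z. z \<in> ball (cpoint a) e \<Longrightarrow> Im z * u z = - Im (deriv K z)"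
    and w: "\<And>z. z \<in> ball (cpoint a) e \<Longrightarrow> (Im z)\<^sup>2 * w z = Im z * Re (deriv K z) - Im (K z)"
    and u0: "\<And>z. z \<in> ball (cpoint a) e \<Longrightarrow> Im z = 0 \<Longrightarrow> deriv (deriv K) z = - of_real (u z)"
    and w0: "\<And>z. z \<in> ball (cpoint a) e \<Longrightarrow> Im z = 0 \<Longrightarrow> w z = 0"
    and a0: "imnorm a = 0"
  obtains U W where "analytic0 U" "analytic0 W"
    "\<forall>\<^sub>F x in nhds 0. u (cpoint (a + x)) = U x \<and> w (cpoint (a + x)) = imnorm (a + x) * W x"
proof -
  define c where "c = cpoint a"
  have ai: "a$i = 0" if "i \<noteq> 0" for i
  proof -
    have "imsq a = 0" using a0 imnorm_power2[of a] by simp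
    then show ?thesis unfolding imsq_def using that by (subst (asm) sum_nonneg_eq_0_iff) auto
  qed
  have imn: "imnorm (a + x) = imnorm x" for x
    unfolding imnorm_def imsq_def using ai by (auto intro!: sum.cong arg_cong[of _ _ sqrt])
  have cp: "cpoint (a + x) = c + Complex (x$0) (imnorm x)" for x
    using a0 by (simp add: c_def cpoint_def imn complex_eq_iff)
  have Imc: "Im c = 0" by (simp add: c_def cpoint_def a0)
  define q where "q n = Re ((deriv ^^ n) K c)" for n
  have ImK0: "Im (K z) = 0" if "z \<in> ball c e" "Im z = 0" for z
    using w[folded c_def, OF that(1)] that(2) by simp
  have q: "(deriv ^^ n) K c = of_real (q n)" for n
    using Im_higher_deriv_eq_0[OF K[folded c_def] ImK0, of c n] e Imc by (simp add: q_def complex_eq_iff)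
  have q': "(deriv ^^ n) (deriv K) c = of_real (q (Suc n))" for n
    using q[of "Suc n"] by (simp add: funpow_swap1)
  have q'': "(deriv ^^ n) (deriv (deriv K)) c = of_real (q (Suc (Suc n)))" for n
    using q'[of "Suc n"] by (simp add: funpow_swap1)
  have dK: "deriv K holomorphic_on ball c e" "deriv (deriv K) holomorphic_on ball c e"
    using K by (auto simp: c_def intro!: holomorphic_deriv)
  note ps = holomorphic_has_sum[OF K[folded c_def]] holomorphic_has_sum[OF dK(1)] holomorphic_has_sum[OF dK(2)]
  have "complex_of_real b / fact n = of_real (b / fact n)" for b n by simp
  note ps = ps[unfolded q q' q'' this]
  \<comment> \<open>The bound for \<open>Vpoly n\<close> grows like (8 \<rho>)^n, so 8 \<rho> has to
    stay below the radius \<open>e\<close> of the Taylor series.\<close>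
  define \<rho> where "\<rho> = e / 9"
  have \<rho>: "\<rho> > 0" "8 * \<rho> < e" using e by (auto simp: \<rho>_def)
  note maj\<tau> = majorized_coord[OF \<rho>(1), of "0::8"] and majy = majorized_imsq[OF \<rho>(1)]
  \<comment> \<open>With real coefficients, Im K' is the sum of q(n+1)/n! r Spoly n, and by
    \<open>Vpoly_mult\<close> r Re K' - Im K is the sum of q(n)/n! r^3 Vpoly n. Division by - r and
    by r^3 yields the series for u and w / r.\<close>
  define U where "U x = (\<Sum>\<^sub>\<infinity>n. - (q (Suc n) / fact n) * Spoly n (x$0) (imsq x))" for x
  define W where "W x = (\<Sum>\<^sub>\<infinity>n. (q n / fact n) * Vpoly n (x$0) (imsq x))" for x
  have mS: "majorized \<rho> (\<bar>- (q (Suc n) / fact n)\<bar> * ((4 * \<rho>) ^ n / (3 * \<rho>)))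
      (\<lambda>x::real^8. - (q (Suc n) / fact n) * Spoly n (x$0) (imsq x))" for n
    using majorized_Tpoly_Spoly[OF \<rho>(1) maj\<tau> majy] by (intro majorized_cmult \<rho>) blast
  have mV: "majorized \<rho> (\<bar>q n / fact n\<bar> * ((8 * \<rho>) ^ n / \<rho> ^ 3))
      (\<lambda>x::real^8. (q n / fact n) * Vpoly n (x$0) (imsq x))" for n
    using majorized_Vpoly[OF \<rho>(1) maj\<tau> majy] by (intro majorized_cmult \<rho>) blast
  have "summable (\<lambda>n. \<bar>q (Suc n) / fact n\<bar> * (4 * \<rho>) ^ n)"
    using ps(4)[of "of_real (4 * \<rho>)"] \<rho> by (simp del: of_real_divide)
  then have "(\<lambda>n. \<bar>q (Suc n) / fact n\<bar> * (4 * \<rho>) ^ n) summable_on UNIV"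
    by (rule summable_nonneg_imp_summable_on) (use \<rho> in auto)
  from summable_on_cmult_left[OF this, of "1 / (3 * \<rho>)"]
  have sS: "(\<lambda>n. \<bar>- (q (Suc n) / fact n)\<bar> * ((4 * \<rho>) ^ n / (3 * \<rho>))) summable_on UNIV"
    by simp
  have "summable (\<lambda>n. \<bar>q n / fact n\<bar> * (8 * \<rho>) ^ n)"
    using ps(2)[of "of_real (8 * \<rho>)"] \<rho> by (simp del: of_real_divide)
  then have "(\<lambda>n. \<bar>q n / fact n\<bar> * (8 * \<rho>) ^ n) summable_on UNIV"
    by (rule summable_nonneg_imp_summable_on) (use \<rho> in auto)
  from summable_on_cmult_left[OF this, of "1 / \<rho> ^ 3"]
  have sV: "(\<lambda>n. \<bar>q n / fact n\<bar> * ((8 * \<rho>) ^ n / \<rho> ^ 3)) summable_on UNIV"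
    by simp
  have aU: "analytic0 U" and aW: "analytic0 W"
    unfolding U_def[abs_def] W_def[abs_def]
    by (rule analytic0I[OF \<rho>(1) majorized_infsum(1)[OF \<rho>(1) mS sS]],
        rule analytic0I[OF \<rho>(1) majorized_infsum(1)[OF \<rho>(1) mV sV]])
  have eq: "u (cpoint (a + x)) = U x \<and> w (cpoint (a + x)) = imnorm (a + x) * W x"
    if x: "x \<in> cube \<rho>" "norm (Complex (x$0) (imnorm x)) < e" for x
  proof -
    define \<tau> r z where "\<tau> = x$0" and "r = imnorm x" and "z = cpoint (a + x)"
    have z: "z = c + Complex \<tau> r" by (simp add: z_def cp \<tau>_def r_def)
    have zB: "z \<in> ball c e" using x(2) by (simp add: z \<tau>_def r_def dist_norm)
    have Imz: "Im z = r" by (simp add: z Imc)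
    have y: "imsq x = r\<^sup>2" by (simp add: r_def imnorm_power2)
    have hU: "((\<lambda>n. - (q (Suc n) / fact n) * Spoly n \<tau> (r\<^sup>2)) has_sum U x) UNIV"
      using majorized_infsum(2)[OF \<rho>(1) mS sS x(1)] by (simp add: U_def \<tau>_def y)
    have hW: "((\<lambda>n. q n / fact n * Vpoly n \<tau> (r\<^sup>2)) has_sum W x) UNIV"
      using majorized_infsum(2)[OF \<rho>(1) mV sV x(1)] by (simp add: W_def \<tau>_def y)
    have n: "norm (Complex \<tau> r) < e" using x(2) by (simp add: \<tau>_def r_def)
    have ImK: "((\<lambda>n. q n / fact n * (r * Spoly n \<tau> (r\<^sup>2))) has_sum Im (K z)) UNIV"
      using has_sum_bounded_linear[OF bounded_linear_Im ps(1)[OF n]]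
      by (simp add: Complex_power z del: of_real_divide)
    have ReK': "((\<lambda>n. q (Suc n) / fact n * Tpoly n \<tau> (r\<^sup>2)) has_sum Re (deriv K z)) UNIV"
      using has_sum_bounded_linear[OF bounded_linear_Re ps(3)[OF n]]
      by (simp add: Complex_power z del: of_real_divide)
    have ImK': "((\<lambda>n. q (Suc n) / fact n * (r * Spoly n \<tau> (r\<^sup>2))) has_sum Im (deriv K z)) UNIV"
      using has_sum_bounded_linear[OF bounded_linear_Im ps(3)[OF n]]
      by (simp add: Complex_power z del: of_real_divide)
    have "u z = U x"
    proof (cases "r = 0")
      case False
      have "((\<lambda>n. q (Suc n) / fact n * (r * Spoly n \<tau> (r\<^sup>2))) has_sum - r * U x) UNIV"
        using has_sum_cmult_right[OF hU, of "- r"] by (simp add: mult_ac)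
      then have "- r * U x = Im (deriv K z)" using ImK' has_sum_unique by blast
      then have "r * u z = r * U x" using u[folded c_def, OF zB] by (simp add: Imz)
      then show ?thesis using False by simp
    next
      case True
      \<comment> \<open>On the axis \<open>Spoly (Suc n)\<close> reduces to (n + 1) \<tau>^n, so
        after dropping the zero term at n = 0 the series is that of - K''.\<close>
      let ?f = "\<lambda>n. - (q (Suc n) / fact n) * Spoly n \<tau> 0"
      have "((\<lambda>n. ?f (Suc n)) has_sum U x) UNIV"
        using hU True by (subst has_sum_Suc_iff) auto
      moreover have "?f (Suc n) = - (q (Suc (Suc n)) / fact n * \<tau> ^ n)" for n
        unfolding Spoly_zero by (simp add: divide_simps)
      ultimately have "((\<lambda>n. - (q (Suc (Suc n)) / fact n * \<tau> ^ n)) has_sum U x) UNIV"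
        by simp
      moreover have "Complex \<tau> r = of_real \<tau>" using True by (simp add: complex_eq_iff)
      then have "((\<lambda>n. q (Suc (Suc n)) / fact n * \<tau> ^ n) has_sum Re (deriv (deriv K) z)) UNIV"
        using has_sum_bounded_linear[OF bounded_linear_Re ps(5)[OF n]]
        by (simp add: z del: of_real_divide flip: of_real_power)
      from has_sum_cmult_right[OF this, of "-1"]
      have "((\<lambda>n. - (q (Suc (Suc n)) / fact n * \<tau> ^ n)) has_sum - Re (deriv (deriv K) z)) UNIV"
        by simp
      ultimately have "U x = - Re (deriv (deriv K) z)" using has_sum_unique by blast
      then show ?thesis using u0[folded c_def, OF zB] True by (simp add: Imz)
    qed
    moreover have "w z = r * W x"
    proof (cases "r = 0")
      case True
      then show ?thesis using w0[folded c_def, OF zB] by (simp add: Imz)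
    next
      case False
      \<comment> \<open>The series of Re K' with its index raised by one, so that its terms combine
        with those of Im K as in \<open>Vpoly_mult\<close>.\<close>
      let ?g = "\<lambda>n. q n / fact n * (real n * Tpoly (n - 1) \<tau> (r\<^sup>2))"
      have "?g (Suc n) = q (Suc n) / fact n * Tpoly n \<tau> (r\<^sup>2)" for n
        by (simp add: divide_simps)
      then have "((\<lambda>n. ?g (Suc n)) has_sum Re (deriv K z)) UNIV" using ReK' by simp
      then have "(?g has_sum Re (deriv K z)) UNIV" by (subst (asm) has_sum_Suc_iff) auto
      from has_sum_add[OF has_sum_cmult_right[OF this, of r] has_sum_cmult_right[OF ImK, of "-1"]]
      have h1: "((\<lambda>n. q n / fact n * r * (r\<^sup>2 * Vpoly n \<tau> (r\<^sup>2))) has_sum r * Re (deriv K z) - Im (K z)) UNIV"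
        unfolding Vpoly_mult by (simp add: algebra_simps)
      have "((\<lambda>n. q n / fact n * r * (r\<^sup>2 * Vpoly n \<tau> (r\<^sup>2))) has_sum r * r\<^sup>2 * W x) UNIV"
        using has_sum_cmult_right[OF hW, of "r * r\<^sup>2"] by (simp add: mult_ac)
      from has_sum_unique[OF this h1] have "r * r\<^sup>2 * W x = r\<^sup>2 * w z"
        using w[folded c_def, OF zB] by (simp add: Imz)
      then show ?thesis using False by simp
    qed
    ultimately show ?thesis by (simp add: z_def r_def imn)
  qed
  have "\<forall>\<^sub>F x::real^8 in nhds 0. x \<in> cube \<rho>"
    unfolding eventually_nhds_metric
  proof (intro exI[of _ \<rho>] conjI allI impI)
    fix x :: "real^8" assume "dist x 0 < \<rho>"
    then show "x \<in> cube \<rho>"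
      unfolding cube_def using component_le_norm_cart[of x] by (auto intro: order_trans less_imp_le)
  qed (rule \<rho>(1))
  moreover have "open (cpoint -` ball 0 e)"
    by (intro open_vimage open_ball continuous_cpoint)
  from eventually_nhds_in_open[OF this, of 0]
  have "\<forall>\<^sub>F x in nhds 0. norm (cpoint x) < e"
    using e by (simp add: cpoint_def imnorm_def imsq_def complex_norm)
  ultimately have "\<forall>\<^sub>F x in nhds 0. u (cpoint (a + x)) = U x \<and> w (cpoint (a + x)) = imnorm (a + x) * W x"
    by eventually_elim (rule eq, auto simp: cpoint_def)
  then show ?thesis using that aU aW by blast
qed

text \<open>Real functions are routed through the complex numbers so that
  \<open>analytic0_holomorphic\<close> covers the square root and the reciprocal of the imaginary
  norm, by which the formulas for u and w are then divided.\<close>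

lemma slice_analytic_nonreal_point:
  fixes u w :: "complex \<Rightarrow> real" and a :: "real^8"
  assumes e: "e > 0" and K: "K holomorphic_on ball (cpoint a) e"
    and u: "\<And>z. z \<in> ball (cpoint a) e \<Longrightarrow> Im z * u z = - Im (deriv K z)"
    and w: "\<And>z. z \<in> ball (cpoint a) e \<Longrightarrow> (Im z)\<^sup>2 * w z = Im z * Re (deriv K z) - Im (K z)"
    and a0: "imnorm a \<noteq> 0"
  obtains U W where "analytic0 U" "analytic0 W"
    "\<forall>\<^sub>F x in nhds 0. u (cpoint (a + x)) = U x \<and> w (cpoint (a + x)) = imnorm (a + x) * W x"
proof -
  have r0: "imnorm a > 0" using a0 imnorm_nonneg[of a] by linarith
  have aq: "analytic0 (\<lambda>x. complex_of_real (imsq (a + x)))"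
    unfolding imsq_def power2_eq_square vector_add_component
    by (intro analytic0_linear[OF bounded_linear_of_real] analytic0_sum analytic0_mult analytic0_add analytic0_const analytic0_coord)
  \<comment> \<open>The disc of radius \<open>imsq a\<close> about \<open>imsq a\<close> lies in the
    open right half plane, away from the branch cut.\<close>
  have "csqrt holomorphic_on ball (complex_of_real (imsq (a + 0))) (imsq a)"
  proof (rule holomorphic_on_subset[OF holomorphic_on_csqrt])
    show "ball (complex_of_real (imsq (a + 0))) (imsq a) \<subseteq> - \<real>\<^sub>\<le>\<^sub>0"
    proof
      fix z assume "z \<in> ball (complex_of_real (imsq (a + 0))) (imsq a)"
      then have "\<bar>Re (of_real (imsq a) - z)\<bar> < imsq a"
        using abs_Re_le_cmod[of "of_real (imsq a) - z"] by (simp add: dist_norm)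
      then show "z \<in> - \<real>\<^sub>\<le>\<^sub>0" by (auto simp: complex_nonpos_Reals_iff)
    qed
  qed
  moreover have "imsq a > 0" using r0 imnorm_power2[of a] by (metis zero_less_power)
  ultimately have "analytic0 (\<lambda>x. csqrt (complex_of_real (imsq (a + x))))"
    by (rule analytic0_holomorphic[OF aq])
  then have ar: "analytic0 (\<lambda>x. complex_of_real (imnorm (a + x)))"
    by (simp add: imnorm_def imsq_nonneg)
  have ac: "analytic0 (\<lambda>x. cpoint (a + x))"
    unfolding cpoint_eq vector_add_component
    by (intro analytic0_add analytic0_mult analytic0_const ar analytic0_linear[OF bounded_linear_of_real] analytic0_coord)
  have aK: "analytic0 (\<lambda>x. K (cpoint (a + x)))" "analytic0 (\<lambda>x. deriv K (cpoint (a + x)))"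
    using analytic0_holomorphic[OF ac _ e] K holomorphic_deriv[OF K open_ball] by simp_all
  have "inverse holomorphic_on ball (complex_of_real (imnorm (a + 0))) (imnorm a)"
    by (intro holomorphic_on_inverse holomorphic_on_ident) (use r0 in auto)
  from analytic0_holomorphic[OF ar this r0]
  have "analytic0 (\<lambda>x. Re (inverse (complex_of_real (imnorm (a + x)))))"
    by (rule analytic0_linear[OF bounded_linear_Re])
  then have ai: "analytic0 (\<lambda>x. inverse (imnorm (a + x)))"
    by (simp flip: of_real_inverse)
  define U where "U x = - (Im (deriv K (cpoint (a + x))) * inverse (imnorm (a + x)))" for x
  define W where "W x = (Re (deriv K (cpoint (a + x))) - Im (K (cpoint (a + x))) * inverse (imnorm (a + x)))
    * inverse (imnorm (a + x)) * inverse (imnorm (a + x))" for x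
  have "analytic0 U"
    unfolding U_def[abs_def]
    by (intro analytic0_minus analytic0_mult ai analytic0_linear[OF bounded_linear_Im] aK)
  moreover have "analytic0 W"
    unfolding W_def[abs_def]
    by (intro analytic0_diff analytic0_mult ai analytic0_linear[OF bounded_linear_Im] analytic0_linear[OF bounded_linear_Re] aK)
  moreover have "u (cpoint (a + x)) = U x \<and> w (cpoint (a + x)) = imnorm (a + x) * W x"
    if "cpoint (a + x) \<in> ball (cpoint a) e" "imnorm (a + x) > 0" for x
  proof -
    have w_eq: "w (cpoint (a + x)) = (imnorm (a + x) * Re (deriv K (cpoint (a + x))) - Im (K (cpoint (a + x)))) / (imnorm (a + x))\<^sup>2"
      using w[OF that(1)] that(2) by (simp add: cpoint_def eq_divide_eq mult.commute)
    have u_eq: "u (cpoint (a + x)) = - Im (deriv K (cpoint (a + x))) / imnorm (a + x)"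
      using u[OF that(1)] that(2) by (simp add: cpoint_def field_simps)
    show ?thesis
      unfolding U_def W_def w_eq u_eq using that(2) by (simp add: field_simps power2_eq_square)
  qed
  moreover have "open ((\<lambda>x. cpoint (a + x)) -` ball (cpoint a) e)"
    by (intro open_vimage open_ball continuous_on_compose2[OF continuous_cpoint[of UNIV]] continuous_intros) auto
  from eventually_nhds_in_open[OF this, of 0]
  have "\<forall>\<^sub>F x in nhds 0. cpoint (a + x) \<in> ball (cpoint a) e" using e by simp
  moreover have "open ((\<lambda>x. imnorm (a + x)) -` {0<..})"
    by (intro open_vimage open_greaterThan continuous_on_compose2[OF continuous_imnorm[of UNIV]] continuous_intros) auto
  from eventually_nhds_in_open[OF this, of 0]
  have "\<forall>\<^sub>F x in nhds 0. imnorm (a + x) > 0" using r0 by simp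
  ultimately show ?thesis
    by (intro that[of U W]) (auto elim: eventually_elim2)
qed

section \<open>Octonions and equivariance\<close>

lemma qmk_nth [simp]: "qmk a b c d $ 0 = a" "qmk a b c d $ 1 = b" "qmk a b c d $ 2 = c" "qmk a b c d $ 3 = d"
  by (simp_all add: qmk_def)

text \<open>Numerals of type \<open>4\<close> are taken modulo 4, so the index 4 in
  \<open>forall_4\<close> is the coordinate 0 of the definitions.\<close>

lemma forall_4_zero: "(\<forall>i::4. P i) \<longleftrightarrow> P 0 \<and> P 1 \<and> P 2 \<and> P 3"
proof -
  have "(4::4) = 0" by simp
  then show ?thesis using forall_4[of P] by metis
qed

lemma sum_4_zero: "sum f (UNIV::4 set) = f 0 + f 1 + f 2 + f 3"
proof -
  have "(4::4) = 0" by simp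
  then show ?thesis unfolding sum_4 by (simp only: ac_simps)
qed

lemma exhaust_8:
  fixes x :: 8
  shows "x = 0 \<or> x = 1 \<or> x = 2 \<or> x = 3 \<or> x = 4 \<or> x = 5 \<or> x = 6 \<or> x = 7"
proof (induct x)
  case (of_int z)
  then have "z = 0 \<or> z = 1 \<or> z = 2 \<or> z = 3 \<or> z = 4 \<or> z = 5 \<or> z = 6 \<or> z = 7" by simp arith
  then show ?case by auto
qed

lemma forall_8: "(\<forall>i::8. P i) \<longleftrightarrow> P 0 \<and> P 1 \<and> P 2 \<and> P 3 \<and> P 4 \<and> P 5 \<and> P 6 \<and> P 7"
  by (metis exhaust_8)

lemmas omul_defs = omul_def omk_def qmul_def oq1_def oq2_def qconj_def

lemma bounded_bilinear_omul: "bounded_bilinear omul"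
proof -
  have "bilinear omul"
    unfolding bilinear_def
    by (intro conjI allI linearI; simp add: vec_eq_iff forall_8 omul_defs algebra_simps)
  then show ?thesis by (simp add: bilinear_conv_bounded_bilinear)
qed

lemmas omul_zero_right = bounded_bilinear.zero_right[OF bounded_bilinear_omul]
  and omul_scaleR_right = bounded_bilinear.scaleR_right[OF bounded_bilinear_omul]
  and omul_scaleR_left = bounded_bilinear.scaleR_left[OF bounded_bilinear_omul]

lemma omul_self: "omul x x = (\<chi> i. if i = 0 then (x$0)\<^sup>2 - imsq x else 2 * x$0 * x$i)"
proof -
  have "-{0} = {1,2,3,4,5,6,7::8}" using exhaust_8 by auto
  then show ?thesis
    by (simp add: imsq_def vec_eq_iff forall_8 omul_defs algebra_simps power2_eq_square)
qed

text \<open>The components \<open>2 * I$0 * I$i\<close> of the square force the real part or the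
  imaginary part to vanish, and no real number has square -1.\<close>

lemma imag_units_iff: "I \<in> imag_units \<longleftrightarrow> I$0 = 0 \<and> imsq I = 1"
proof
  assume "I \<in> imag_units"
  then have *: "(if i = 0 then (I$0)\<^sup>2 - imsq I else 2 * I$0 * I$i) = - (axis 0 1 $ i)" for i
    unfolding imag_units_def omul_self oone_def by (simp add: vec_eq_iff)
  have sq: "(I$0)\<^sup>2 - imsq I = -1" using *[of 0] by simp
  have "I$0 = 0"
  proof (rule ccontr)
    assume n: "I$0 \<noteq> 0"
    have "I$i = 0" if "i \<noteq> 0" for i using *[of i] n that by (simp add: axis_def)
    then have "imsq I = 0" unfolding imsq_def by simp
    then show False using sq zero_le_power2[of "I$0"] by simp
  qed
  then show "I$0 = 0 \<and> imsq I = 1" using sq by simp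
next
  assume "I$0 = 0 \<and> imsq I = 1"
  then show "I \<in> imag_units"
    unfolding imag_units_def omul_self oone_def by (auto simp: vec_eq_iff axis_def)
qed

lemma imsq_scaleR: "imsq (b *\<^sub>R x) = b\<^sup>2 * imsq x"
  by (simp add: imsq_def power_mult_distrib sum_distrib_left)

lemma imsq_add_real: "imsq (b *\<^sub>R oone + x) = imsq x"
  unfolding imsq_def oone_def by (rule sum.cong) (auto simp: axis_def)

lemma inner_self_imsq: "x \<bullet> x = (x$0)\<^sup>2 + imsq x"
  unfolding inner_vec_def imsq_def Compl_eq_Diff_UNIV
  by (subst sum.remove[of UNIV 0]) (auto simp: power2_eq_square)

text \<open>A point of the domain provides one unit, while \<open>O3_induces\<close> speaks of
  pairs. As 1 and \<open>I\<close> span at most 2 of 8 dimensions, some vector is orthogonal to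
  both, and orthogonality to 1 makes it imaginary.\<close>

lemma ex_orth_pair:
  assumes "I \<in> imag_units"
  obtains J where "(I, J) \<in> orth_pairs"
proof -
  have "dim {oone, I} \<le> card {oone, I}" by (rule dim_le_card) (auto intro: span_base)
  also have "\<dots> \<le> 2" by (simp add: card_insert_if)
  finally have "dim {oone, I} < DIM(real^8)" by simp
  then obtain x where x: "x \<noteq> 0" "\<And>y. y \<in> span {oone, I} \<Longrightarrow> orthogonal x y"
    using orthogonal_to_subspace_exists by blast
  have x0: "x$0 = 0"
    using x(2)[of oone] by (simp add: span_base orthogonal_def oone_def inner_axis)
  have xI: "I \<bullet> x = 0"
    using x(2)[of I] by (simp add: span_base orthogonal_def inner_commute)
  define J where "J = (1 / norm x) *\<^sub>R x"
  have "imsq J = (1 / norm x)\<^sup>2 * (x \<bullet> x)"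
    by (simp add: J_def imsq_scaleR inner_self_imsq x0)
  then have "imsq J = 1" using x(1) by (simp add: power_divide power2_norm_eq_inner)
  moreover have "J$0 = 0" "I \<bullet> J = 0" by (simp_all add: J_def x0 xI)
  ultimately show ?thesis using assms by (intro that[of J]) (simp add: orth_pairs_def imag_units_iff)
qed

lemma imag_unit_decomp:
  obtains I where "I \<in> imag_units" "x = (x$0) *\<^sub>R oone + imnorm x *\<^sub>R I"
proof (cases "imnorm x = 0")
  case True
  then have "imsq x = 0" using imnorm_power2[of x] by simp
  then have "x$i = 0" if "i \<noteq> 0" for i
    unfolding imsq_def using that by (subst (asm) sum_nonneg_eq_0_iff) auto
  \<comment> \<open>At a real point any imaginary unit will do; here it is the basis element
    i.\<close>
  then have "x = (x$0) *\<^sub>R oone + imnorm x *\<^sub>R axis 1 1"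
    using True by (simp add: vec_eq_iff oone_def axis_def)
  moreover have "axis 1 1 \<in> imag_units"
    unfolding imag_units_iff imsq_def by (simp add: axis_def if_distrib[of "\<lambda>x. x\<^sup>2"] cong: if_cong)
  ultimately show ?thesis using that by blast
next
  case False
  define I where "I = (1 / imnorm x) *\<^sub>R (x - (x$0) *\<^sub>R oone)"
  have "imsq (x - (x$0) *\<^sub>R oone) = imsq x"
    using imsq_add_real[of "- x$0" x] by simp
  then have "imsq I = (1 / imnorm x)\<^sup>2 * (imnorm x)\<^sup>2"
    by (simp add: I_def imsq_scaleR imnorm_power2)
  then have "imsq I = 1" using False by (simp add: power_divide)
  moreover have "I$0 = 0" by (simp add: I_def oone_def)
  ultimately show ?thesis using False by (intro that[of I]) (auto simp: imag_units_iff I_def)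
qed

text \<open>Only the absolute value of \<beta> is visible in \<open>x\<close>; the symmetry of
  \<open>D\<close> absorbs the sign.\<close>

lemma OmegaD_iff:
  assumes "\<forall>\<alpha> \<beta>. (\<alpha>, \<beta>) \<in> D \<longrightarrow> (\<alpha>, - \<beta>) \<in> D"
  shows "x \<in> OmegaD D \<longleftrightarrow> (x$0, imnorm x) \<in> D"
proof
  assume "x \<in> OmegaD D"
  then obtain \<alpha> \<beta> I where x: "x = \<alpha> *\<^sub>R oone + \<beta> *\<^sub>R I" and D: "(\<alpha>, \<beta>) \<in> D" and I: "I$0 = 0" "imsq I = 1"
    unfolding OmegaD_def imag_units_iff by blast
  have "x$0 = \<alpha>" "imnorm x = \<bar>\<beta>\<bar>"
    by (simp_all add: x I oone_def imnorm_def imsq_add_real[unfolded oone_def] imsq_scaleR)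
  then show "(x$0, imnorm x) \<in> D" using D assms by (auto simp: abs_if)
next
  assume D: "(x$0, imnorm x) \<in> D"
  then show "x \<in> OmegaD D"
    using imag_unit_decomp[of x] unfolding OmegaD_def by blast
qed

lemma open_EsetD: "open D \<Longrightarrow> open (EsetD D)"
proof -
  assume "open D"
  moreover have "EsetD D = (\<lambda>v. (v$0, sqrt ((v$1)\<^sup>2 + (v$2)\<^sup>2 + (v$3)\<^sup>2))) -` D"
    by (auto simp: EsetD_def)
  ultimately show ?thesis by (auto intro!: open_vimage continuous_intros)
qed

section \<open>Equivariance and the partial derivatives of the stem function\<close>

lemma has_derivative_pd:
  assumes "C1_on F E" "open E" "v \<in> E"
  shows "(F has_derivative (\<lambda>h. \<Sum>i\<in>UNIV. h$i *\<^sub>R pd F i v)) (at v)"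
proof -
  have d: "(F has_derivative frechet_derivative F (at v)) (at v)"
    using assms unfolding C1_on_def by (simp add: differentiable_on_eq_differentiable_at frechet_derivative_works)
  then interpret bounded_linear "frechet_derivative F (at v)" by (rule has_derivative_bounded_linear)
  have "frechet_derivative F (at v) h = (\<Sum>i\<in>UNIV. h$i *\<^sub>R pd F i v)" for h
  proof -
    have "h = (\<Sum>i\<in>UNIV. h$i *\<^sub>R axis i 1)"
      using basis_expansion[of h] by (simp add: scalar_mult_eq_scaleR)
    then have "frechet_derivative F (at v) h = frechet_derivative F (at v) (\<Sum>i\<in>UNIV. h$i *\<^sub>R axis i 1)" by simp
    also have "\<dots> = (\<Sum>i\<in>UNIV. h$i *\<^sub>R pd F i v)" by (simp add: sum scaleR pd_def)
    finally show ?thesis .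
  qed
  then show ?thesis using d by presburger
qed

lemma O3_stem_eq:
  assumes "is_O3_stem D F" "v \<in> EsetD D" "A \<in> O3"
  shows "F (A *v v) $ h = (\<Sum>k\<in>UNIV. A$h$k *\<^sub>R F v $ k)"
  using assms by (simp add: is_O3_stem_def oact_def)

text \<open>The reflection in coordinate \<open>k\<close> fixes \<open>v\<close>, while by
  equivariance it negates component \<open>k\<close> of the value.\<close>

lemma O3_stem_zero:
  assumes "is_O3_stem D F" "v \<in> EsetD D" "k \<noteq> 0" "v$k = 0"
  shows "F v $ k = 0"
proof -
  define A :: "real^4^4" where "A = (\<chi> i j. if i = j then if i = k then -1 else 1 else 0)"
  have "transpose A ** A = mat 1"
    by (simp add: A_def transpose_def matrix_matrix_mult_def mat_def vec_eq_iff if_distrib[of "\<lambda>x. x * _"] sum.delta cong: if_cong)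
  moreover have Av: "A *v w = (\<chi> i. if i = k then - w$i else w$i)" for w
    by (simp add: A_def matrix_vector_mult_def vec_eq_iff if_distrib[of "\<lambda>x. x * _"] sum.delta cong: if_cong)
  then have "A *v axis 0 1 = axis 0 1" using assms(3) by (auto simp: vec_eq_iff axis_def)
  ultimately have "A \<in> O3" by (simp add: O3_def orthogonal_matrix)
  from O3_stem_eq[OF assms(1,2) this, of k]
  have "F (A *v v) $ k = - F v $ k"
    by (simp add: A_def if_distrib[of "\<lambda>x. x *\<^sub>R _"] sum.delta cong: if_cong)
  moreover have "A *v v = v" using assms(4) by (simp add: Av vec_eq_iff)
  ultimately have "F v $ k = - F v $ k" by simp
  then show ?thesis by (simp add: vec_eq_iff)
qed

text \<open>A line in a direction \<open>i \<noteq> k\<close> stays in the hyperplane of vanishing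
  coordinate \<open>k\<close>, where \<open>O3_stem_zero\<close> applies.\<close>

lemma O3_stem_pd_zero:
  assumes "is_O3_stem D F" "open D" "C1_on F (EsetD D)" "v \<in> EsetD D" "k \<noteq> 0" "v$k = 0" "i \<noteq> k"
  shows "pd F i v $ k = 0"
proof -
  note o = open_EsetD[OF assms(2)]
  have l: "((\<lambda>s. v + s *\<^sub>R axis i 1) has_derivative (\<lambda>s. s *\<^sub>R axis i 1)) (at 0)"
    by (auto intro!: derivative_eq_intros)
  have "(F has_derivative (\<lambda>h. \<Sum>i\<in>UNIV. h$i *\<^sub>R pd F i v)) (at (v + 0 *\<^sub>R axis i 1))"
    using has_derivative_pd[OF assms(3) o assms(4)] by simp
  from bounded_linear.has_derivative[OF bounded_linear_vec_nth has_derivative_compose[OF l this], of k]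
  have "((\<lambda>s. F (v + s *\<^sub>R axis i 1) $ k) has_derivative (\<lambda>s. s *\<^sub>R pd F i v $ k)) (at 0)"
    by (simp add: axis_def if_distrib[of "\<lambda>x. _ * x"] if_distrib[of "\<lambda>x. x *\<^sub>R _"] sum.delta cong: if_cong)
  moreover have "((\<lambda>s. F (v + s *\<^sub>R axis i 1) $ k) has_derivative (\<lambda>s. 0)) (at 0)"
  proof (rule has_derivative_transform_within_open[OF has_derivative_const[of 0]])
    show "open ((\<lambda>s. v + s *\<^sub>R axis i 1) -` EsetD D)"
      by (intro open_vimage o continuous_intros)
    show "0 = F (v + s *\<^sub>R axis i 1) $ k" if "s \<in> (\<lambda>s. v + s *\<^sub>R axis i 1) -` EsetD D" for s
      using O3_stem_zero[OF assms(1) _ assms(5), of "v + s *\<^sub>R axis i 1"] that assms(6,7) by (simp add: axis_def)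
  qed (use assms(4) in simp)
  ultimately have "(\<lambda>s. s *\<^sub>R pd F i v $ k) = (\<lambda>s. 0)" by (rule has_derivative_unique)
  from fun_cong[OF this, of 1] show ?thesis by simp
qed

text \<open>Differentiating the equivariance along the rotations in the plane of the coordinates 1 and k.\<close>

lemma O3_stem_pd_rotation:
  assumes stem: "is_O3_stem D F" and D: "open D" and C1: "C1_on F (EsetD D)"
    and v: "v = qmk t r 0 0" "v \<in> EsetD D" and k: "k = 2 \<or> k = 3"
  shows "r *\<^sub>R pd F k v $ k = F v $ 1"
proof -
  define A :: "real \<Rightarrow> real^4^4" where "A \<theta> = (\<chi> i j. if i = 1 \<and> j = 1 \<or> i = k \<and> j = k then cos \<theta>
    else if i = 1 \<and> j = k then - sin \<theta> else if i = k \<and> j = 1 then sin \<theta> else if i = j then 1 else 0)" for \<theta>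
  have "transpose (A \<theta>) ** A \<theta> = mat 1" for \<theta>
    using k sin_cos_squared_add[of \<theta>]
    by (auto simp: A_def transpose_def matrix_matrix_mult_def mat_def vec_eq_iff forall_4_zero sum_4_zero power2_eq_square add.commute)
  moreover have "A \<theta> *v axis 0 1 = axis 0 1" for \<theta>
    using k by (auto simp: A_def matrix_vector_mult_def vec_eq_iff forall_4_zero sum_4_zero axis_def)
  ultimately have A: "A \<theta> \<in> O3" for \<theta> by (simp add: O3_def orthogonal_matrix)
  have Av: "A \<theta> *v v = t *\<^sub>R axis 0 1 + (r * cos \<theta>) *\<^sub>R axis 1 1 + (r * sin \<theta>) *\<^sub>R axis k 1" for \<theta>
    using k by (auto simp: v(1) A_def matrix_vector_mult_def vec_eq_iff forall_4_zero sum_4_zero axis_def)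
  have Fk: "F v $ k = 0" using k v by (intro O3_stem_zero[OF stem v(2)]) auto
  \<comment> \<open>Row \<open>k\<close> of the rotation yields sin \<theta> F_1 + cos \<theta> F_k,
    and F_k vanishes at \<open>v\<close>. The rotated point leaves \<open>v\<close> with velocity r
    in direction \<open>k\<close>, so comparing derivatives at 0 gives the claim.\<close>
  have F: "F (A \<theta> *v v) $ k = sin \<theta> *\<^sub>R F v $ 1" for \<theta>
    unfolding O3_stem_eq[OF stem v(2) A] using k Fk by (auto simp: A_def sum_4_zero)
  have l: "((\<lambda>\<theta>. A \<theta> *v v) has_derivative (\<lambda>s. (s * r) *\<^sub>R axis k 1)) (at 0)"
    unfolding Av by (auto intro!: derivative_eq_intros)
  have "A 0 *v v = v" unfolding Av using k by (auto simp: v(1) vec_eq_iff forall_4_zero axis_def)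
  then have "(F has_derivative (\<lambda>h. \<Sum>i\<in>UNIV. h$i *\<^sub>R pd F i v)) (at (A 0 *v v))"
    using has_derivative_pd[OF C1 open_EsetD[OF D] v(2)] by simp
  from bounded_linear.has_derivative[OF bounded_linear_vec_nth has_derivative_compose[OF l this], of k]
  have "((\<lambda>\<theta>. sin \<theta> *\<^sub>R F v $ 1) has_derivative (\<lambda>s. (s * r) *\<^sub>R pd F k v $ k)) (at 0)"
    by (simp add: F axis_def if_distrib[of "\<lambda>x. _ * x"] if_distrib[of "\<lambda>x. x *\<^sub>R _"] sum.delta cong: if_cong)
  moreover have "((\<lambda>\<theta>. sin \<theta> *\<^sub>R F v $ 1) has_derivative (\<lambda>s. s *\<^sub>R F v $ 1)) (at 0)"
    by (auto intro!: derivative_eq_intros)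
  ultimately have "(\<lambda>s. (s * r) *\<^sub>R pd F k v $ k) = (\<lambda>s. s *\<^sub>R F v $ 1)" by (rule has_derivative_unique)
  from fun_cong[OF this, of 1] show ?thesis by simp
qed

theorem theorem2p2:
  fixes D :: "(real \<times> real) set" and f :: "real^8 \<Rightarrow> real^8"
  assumes "open D" and "D \<noteq> {}"
    and "\<forall>\<alpha> \<beta>. (\<alpha>, \<beta>) \<in> D \<longrightarrow> (\<alpha>, - \<beta>) \<in> D"
    and "connected (OmegaD D)"
    and "slice_fueter_regular D f"
  shows "real_analytic_on f (OmegaD D)"
proof -
  note D = assms(1) and sym = assms(3)
  obtain F where stem: "is_O3_stem D F" and ind: "O3_induces D F f" and C1: "C1_on F (EsetD D)"
    and pde: "\<And>v. v \<in> EsetD D \<Longrightarrow> pd F 0 v $ 0 - pd F 1 v $ 1 - pd F 2 v $ 2 - pd F 3 v $ 3 = 0 \<and>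
         pd F 1 v $ 0 + pd F 0 v $ 1 - pd F 3 v $ 2 + pd F 2 v $ 3 = 0"
    using assms(5) unfolding slice_fueter_regular_def by blast
  define V where "V z = qmk (Re z) (Im z) 0 0" for z
  define Dc where "Dc = {z. (Re z, Im z) \<in> D}"
  have "Dc = (\<lambda>z. (Re z, Im z)) -` D" by (auto simp: Dc_def)
  then have Dc: "open Dc" using D by (auto intro!: open_vimage continuous_intros)
  \<comment> \<open>By symmetry of \<open>D\<close> negative \<open>Im z\<close> is allowed as well,
    so \<open>Dc\<close> contains whole discs around its real points and K is holomorphic across the
    axis.\<close>
  have VE: "V z \<in> EsetD D" if "z \<in> Dc" for z
    using that sym by (auto simp: V_def EsetD_def Dc_def abs_if)
  have Om: "x \<in> OmegaD D \<longleftrightarrow> cpoint x \<in> Dc" for x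
    by (simp add: OmegaD_iff[OF sym] Dc_def cpoint_def)
  have "OmegaD D = cpoint -` Dc" using Om by auto
  then have open_Om: "open (OmegaD D)"
    using Dc by (auto intro!: open_vimage continuous_cpoint)

  have F23: "F (V z) $ 2 = 0" "F (V z) $ 3 = 0" if "z \<in> Dc" for z
    using O3_stem_zero[OF stem VE[OF that]] by (simp_all add: V_def)
  have pd0: "pd F 3 (V z) $ 2 = 0" "pd F 2 (V z) $ 3 = 0" if "z \<in> Dc" for z
    using O3_stem_pd_zero[OF stem D C1 VE[OF that]] by (simp_all add: V_def)
  have pdr: "Im z *\<^sub>R pd F 2 (V z) $ 2 = F (V z) $ 1" "Im z *\<^sub>R pd F 3 (V z) $ 3 = F (V z) $ 1"
    if "z \<in> Dc" for z
    using O3_stem_pd_rotation[OF stem D C1 V_def VE[OF that]] by simp_all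
  have eq1: "Im z *\<^sub>R pd F 0 (V z) $ 0 = Im z *\<^sub>R pd F 1 (V z) $ 1 + 2 *\<^sub>R F (V z) $ 1" if "z \<in> Dc" for z
  proof -
    have "Im z *\<^sub>R pd F 0 (V z) $ 0
        = Im z *\<^sub>R (pd F 1 (V z) $ 1 + pd F 2 (V z) $ 2 + pd F 3 (V z) $ 3)"
      using pde[OF VE[OF that]] by (simp add: algebra_simps)
    then show ?thesis using pdr[OF that] by (simp add: scaleR_add_right scaleR_2)
  qed
  have eq2: "pd F 0 (V z) $ 1 = - pd F 1 (V z) $ 0" if "z \<in> Dc" for z
    using pde[OF VE[OF that]] pd0[OF that] by (simp add: add_eq_0_iff2)
  have contV: "continuous_on Dc V"
  proof -
    have "V = (\<lambda>z. Re z *\<^sub>R axis 0 1 + Im z *\<^sub>R axis 1 1)"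
      by (auto simp: V_def fun_eq_iff vec_eq_iff forall_4_zero axis_def)
    then show ?thesis by (auto intro!: continuous_intros)
  qed
  have cont: "continuous_on Dc (\<lambda>z. pd F i (V z) $ k $ j)" for i k j
    using C1 VE unfolding C1_on_def
    by (intro continuous_on_component continuous_on_compose2[OF _ contV]) auto
  have dV: "(V has_derivative V) (at z)" for z
  proof -
    have "V = (\<lambda>z. Re z *\<^sub>R axis 0 1 + Im z *\<^sub>R axis 1 1)"
      by (auto simp: V_def fun_eq_iff vec_eq_iff forall_4_zero axis_def)
    then show ?thesis by (auto intro!: derivative_eq_intros)
  qed
  have dF: "((\<lambda>z. F (V z) $ k $ j) has_derivative
      (\<lambda>h. Re h * pd F 0 (V z) $ k $ j + Im h * pd F 1 (V z) $ k $ j)) (at z)" if "z \<in> Dc" for z k j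
  proof -
    have "((\<lambda>z. F (V z) $ k $ j) has_derivative (\<lambda>h. (\<Sum>i\<in>UNIV. V h $ i *\<^sub>R pd F i (V z)) $ k $ j)) (at z)"
      by (intro bounded_linear.has_derivative[OF bounded_linear_vec_nth]
          has_derivative_compose[OF dV has_derivative_pd[OF C1 open_EsetD[OF D] VE[OF that]]])
    then show ?thesis by (simp add: sum_4_zero V_def)
  qed

  have f_eq: "f x = F (V (cpoint x)) $ 0 + omul I (F (V (cpoint x)) $ 1)"
    if x: "x \<in> OmegaD D" and I: "I \<in> imag_units" "x = (x$0) *\<^sub>R oone + imnorm x *\<^sub>R I" for x I
  proof -
    \<comment> \<open>Any admissible J will do, since the terms with J and I J carry F_2 and F_3,
      which vanish on the plane.\<close>
    obtain J where J: "(I, J) \<in> orth_pairs" using ex_orth_pair[OF I(1)] .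
    have z: "cpoint x \<in> Dc" using x Om by blast
    have "f ((x$0) *\<^sub>R oone + imnorm x *\<^sub>R I) = F (V (cpoint x)) $ 0 + omul I (F (V (cpoint x)) $ 1)"
      using ind[unfolded O3_induces_def, rule_format, OF VE[OF z] J]
      by (simp add: F23[OF z] omul_zero_right) (simp add: V_def cpoint_def)
    then show ?thesis using I(2) by simp
  qed
  have "analytic0 (\<lambda>x. f (a + x))" if a: "a \<in> OmegaD D" for a
  proof -
    obtain e where e: "e > 0" "ball (cpoint a) e \<subseteq> Dc"
      using a Om Dc open_contains_ball by blast
    \<comment> \<open>The system on the plane has real coefficients, so each of the eight real
      coordinates of F_0 and F_1 can be treated on its own.\<close>
    define P where "P j U W \<longleftrightarrow> analytic0 U \<and> analytic0 W \<and> (\<forall>\<^sub>F x in nhds 0.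
        F (V (cpoint (a + x))) $ 0 $ j = U x \<and> F (V (cpoint (a + x))) $ 1 $ j = imnorm (a + x) * W x)"
      for j :: 8 and U W :: "real^8 \<Rightarrow> real"
    have "\<exists>U W. P j U W" for j
    proof -
      let ?u = "\<lambda>z. F (V z) $ 0 $ j" and ?w = "\<lambda>z. F (V z) $ 1 $ j"
      have w0: "?w z = 0" if "z \<in> ball (cpoint a) e" "Im z = 0" for z
        using O3_stem_zero[OF stem VE, of z 1] that e by (auto simp: V_def)
      obtain K where K: "K holomorphic_on ball (cpoint a) e"
        "\<And>z. z \<in> ball (cpoint a) e \<Longrightarrow> Im z * ?u z = - Im (deriv K z)"
        "\<And>z. z \<in> ball (cpoint a) e \<Longrightarrow> (Im z)\<^sup>2 * ?w z = Im z * Re (deriv K z) - Im (K z)"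
        "\<And>z. z \<in> ball (cpoint a) e \<Longrightarrow> Im z = 0 \<Longrightarrow> deriv (deriv K) z = - of_real (?u z)"
      proof (rule slice_primitive[of "cpoint a" e ?u "\<lambda>z. pd F 0 (V z) $ 0 $ j" "\<lambda>z. pd F 1 (V z) $ 0 $ j"
            ?w "\<lambda>z. pd F 1 (V z) $ 1 $ j"])
        fix z assume "z \<in> ball (cpoint a) e"
        then have z: "z \<in> Dc" using e by blast
        show "(?u has_derivative (\<lambda>h. Re h * pd F 0 (V z) $ 0 $ j + Im h * pd F 1 (V z) $ 0 $ j)) (at z)"
          by (rule dF[OF z])
        show "(?w has_derivative (\<lambda>h. Im h * pd F 1 (V z) $ 1 $ j - Re h * pd F 1 (V z) $ 0 $ j)) (at z)"
          using dF[OF z, of 1 j] by (simp add: eq2[OF z])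
        show "Im z * pd F 0 (V z) $ 0 $ j = Im z * pd F 1 (V z) $ 1 $ j + 2 * ?w z"
          using arg_cong[OF eq1[OF z], of "\<lambda>x. x $ j"] by simp
      qed (use cont continuous_on_subset e(2) in blast)+
      show ?thesis
      proof (cases "imnorm a = 0")
        case True
        show ?thesis
          by (rule slice_analytic_real_point[of e K a ?u ?w, OF e(1) K(1-4) w0 True])
            (assumption+, unfold P_def, intro exI conjI)
      next
        case False
        show ?thesis
          by (rule slice_analytic_nonreal_point[of e K a ?u ?w, OF e(1) K(1-3) False])
            (assumption+, unfold P_def, intro exI conjI)
      qed
    qed
    then obtain U W where "\<And>j. P j (U j) (W j)" by metis
    then have UW: "\<And>j. analytic0 (U j)" "\<And>j. analytic0 (W j)"
      "\<And>j. \<forall>\<^sub>F x in nhds 0. F (V (cpoint (a + x))) $ 0 $ j = U j x \<and>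
        F (V (cpoint (a + x))) $ 1 $ j = imnorm (a + x) * W j x"
      unfolding P_def by auto
    \<comment> \<open>With F_1 = |y| W the product I F_1 becomes (|y| I) W = y W. The unit I, which
      has no continuous choice at real points, thus disappears.\<close>
    define g where "g x = (\<Sum>j\<in>UNIV. U j x *\<^sub>R axis j 1)
      + omul ((a + x) - (((a + x)$0) *\<^sub>R oone)) (\<Sum>j\<in>UNIV. W j x *\<^sub>R axis j 1)" for x :: "real^8"
    have "analytic0 g"
      unfolding g_def[abs_def] vector_add_component
      by (intro analytic0_add analytic0_sum analytic0_bilinear[OF bounded_bilinear_scaleR] UW analytic0_const
          analytic0_bilinear[OF bounded_bilinear_omul] analytic0_diff analytic0_ident analytic0_coord)
    moreover have "\<forall>\<^sub>F x in nhds 0. g x = f (a + x)"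
    proof -
      have "\<forall>\<^sub>F x in nhds 0. \<forall>j. F (V (cpoint (a + x))) $ 0 $ j = U j x \<and>
          F (V (cpoint (a + x))) $ 1 $ j = imnorm (a + x) * W j x"
        using UW(3) by (simp add: eventually_all_finite)
      moreover have "open ((\<lambda>x. a + x) -` OmegaD D)"
        by (intro open_vimage open_Om continuous_intros)
      from eventually_nhds_in_open[OF this, of 0]
      have "\<forall>\<^sub>F x in nhds 0. a + x \<in> OmegaD D" using a by simp
      ultimately show ?thesis
      proof eventually_elim
        case (elim x)
        obtain I where I: "I \<in> imag_units" "a + x = ((a + x)$0) *\<^sub>R oone + imnorm (a + x) *\<^sub>R I"
          using imag_unit_decomp by blast
        have "F (V (cpoint (a + x))) $ 0 = (\<Sum>j\<in>UNIV. U j x *\<^sub>R axis j 1)"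
          using elim(1) by (subst vec_eq_sum_axis) simp
        moreover have "F (V (cpoint (a + x))) $ 1 = imnorm (a + x) *\<^sub>R (\<Sum>j\<in>UNIV. W j x *\<^sub>R axis j 1)"
          using elim(1) by (subst vec_eq_sum_axis) (simp add: scaleR_sum_right)
        moreover have "(a + x) - ((a + x)$0) *\<^sub>R oone = imnorm (a + x) *\<^sub>R I"
          using I(2) by (simp add: algebra_simps)
        ultimately show ?case
          unfolding g_def f_eq[OF elim(2) I] by (simp add: omul_scaleR_left omul_scaleR_right)
      qed
    qed
    ultimately show ?thesis by (rule analytic0_cong)
  qed
  then show ?thesis by (rule real_analytic_on_analytic0[OF open_Om])
qed

end
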